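(* There exist a dimension $n\in\mathbb{N}$ and a smooth boundary datum $\varphi\in C^\infty(\overline{\Omega})$ on the smooth domain $\Omega=B_1(0)\subset\mathbb{R}^n$ such that no minimiser $u\in\mathscr{N}$ of $F$ on $\mathscr{N}$ lies in $C^2(\Omega)$.
   Context: For $u\in H^2(\Omega)$ set $F(u)=\int_\Omega\left(|\Delta u(x)|^2+1_{\{u\neq 0\}}(x)\right)\,\mathrm{d}x$, where $1_{\{u\ne 0\}}$ is the indicator function of $\{x\in\Omega: u(x)\neq 0\}$. The admissible set is $\mathscr{N}=\{v\in H^2(\Omega): v-\varphi\in H^1_0(\Omega)\}$ (Navier boundary conditions). *)

theory Defs
  imports "HOL-Analysis.Analysis"
begin

text \<open>
  The dimension \<open>n\<close> is quantified inside the statement, so it cannot be a type. Points of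
  \<open>n\<close>-dimensional space are the extensional functions on \<open>{..<n}\<close>, i.e. the elements of
  \<open>space (\<Pi>\<^sub>M i\<in>{..<n}. lborel)\<close>. On this set the product topology of \<open>nat \<Rightarrow> real\<close> restricts
  to the Euclidean one.
\<close>

type_synonym point = "nat \<Rightarrow> real"

definition unit_ball :: "nat \<Rightarrow> point set" where
  "unit_ball n = {x \<in> {..<n} \<rightarrow>\<^sub>E UNIV. L2_set x {..<n} < 1}"

definition vol_on :: "nat \<Rightarrow> point set \<Rightarrow> point measure" where
  "vol_on n \<Omega> = restrict_space (\<Pi>\<^sub>M i\<in>{..<n}. (lborel :: real measure)) \<Omega>"


subsection \<open>Classical derivatives\<close>

definition partial_deriv :: "nat \<Rightarrow> (point \<Rightarrow> real) \<Rightarrow> point \<Rightarrow> real" where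
  "partial_deriv i f x = deriv (\<lambda>t. f (x(i := t))) (x i)"

definition partials :: "nat list \<Rightarrow> (point \<Rightarrow> real) \<Rightarrow> point \<Rightarrow> real" where
  "partials is f = foldr partial_deriv is f"

text \<open>\<open>C_k n k \<Omega>\<close> is meaningful for \<open>\<Omega>\<close> relatively open in \<open>{..<n} \<rightarrow>\<^sub>E UNIV\<close>.\<close>

fun C_k :: "nat \<Rightarrow> nat \<Rightarrow> point set \<Rightarrow> (point \<Rightarrow> real) \<Rightarrow> bool" where
  "C_k n 0 \<Omega> f \<longleftrightarrow> continuous_on \<Omega> f"
| "C_k n (Suc k) \<Omega> f \<longleftrightarrow> continuous_on \<Omega> f \<and>
     (\<forall>i<n. (\<forall>x\<in>\<Omega>. (\<lambda>t. f (x(i := t))) differentiable (at (x i))) \<and>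
            C_k n k \<Omega> (partial_deriv i f))"

definition C_infinity :: "nat \<Rightarrow> point set \<Rightarrow> (point \<Rightarrow> real) \<Rightarrow> bool" where
  "C_infinity n \<Omega> f \<longleftrightarrow> (\<forall>k. C_k n k \<Omega> f)"

text \<open>Smoothness up to the boundary: every derivative extends continuously to the closure.\<close>

definition C_infinity_closure :: "nat \<Rightarrow> point set \<Rightarrow> (point \<Rightarrow> real) \<Rightarrow> bool" where
  "C_infinity_closure n \<Omega> f \<longleftrightarrow> C_infinity n \<Omega> f \<and> continuous_on (closure \<Omega>) f \<and>
     (\<forall>is. set is \<subseteq> {..<n} \<longrightarrow>
        (\<exists>g. continuous_on (closure \<Omega>) g \<and> (\<forall>x\<in>\<Omega>. g x = partials is f x)))"

definition test_function :: "nat \<Rightarrow> point set \<Rightarrow> (point \<Rightarrow> real) \<Rightarrow> bool" where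
  "test_function n \<Omega> \<eta> \<longleftrightarrow> C_infinity n \<Omega> \<eta> \<and>
     (\<exists>K. compact K \<and> K \<subseteq> \<Omega> \<and> (\<forall>x\<in>\<Omega> - K. \<eta> x = 0))"


subsection \<open>Sobolev spaces\<close>

text \<open>
  Elements of the function spaces are represented by Borel measurable functions, only whose values
  on \<open>\<Omega>\<close> matter; every class modulo null sets has such a representative.
\<close>

definition L2 :: "nat \<Rightarrow> point set \<Rightarrow> (point \<Rightarrow> real) set" where
  "L2 n \<Omega> = {u \<in> borel_measurable (vol_on n \<Omega>). integrable (vol_on n \<Omega>) (\<lambda>x. (u x)\<^sup>2)}"

text \<open>Only used for \<open>u\<close> and \<open>v\<close> in \<open>L2 n \<Omega>\<close>, for which both integrals converge.\<close>

definition weak_deriv ::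
  "nat \<Rightarrow> point set \<Rightarrow> nat list \<Rightarrow> (point \<Rightarrow> real) \<Rightarrow> (point \<Rightarrow> real) \<Rightarrow> bool" where
  "weak_deriv n \<Omega> is u v \<longleftrightarrow> (\<forall>\<eta>. test_function n \<Omega> \<eta> \<longrightarrow>
     (\<integral>x. u x * partials is \<eta> x \<partial>vol_on n \<Omega>) = (-1) ^ length is * (\<integral>x. v x * \<eta> x \<partial>vol_on n \<Omega>))"

definition H :: "nat \<Rightarrow> nat \<Rightarrow> point set \<Rightarrow> (point \<Rightarrow> real) set" where
  "H n k \<Omega> = {u \<in> L2 n \<Omega>. \<forall>is. set is \<subseteq> {..<n} \<and> length is \<le> k \<longrightarrow>
     (\<exists>v \<in> L2 n \<Omega>. weak_deriv n \<Omega> is u v)}"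

text \<open>Weak derivatives are unique up to null sets, so the choice below is immaterial under
  integrals.\<close>

definition wderiv ::
  "nat \<Rightarrow> point set \<Rightarrow> nat list \<Rightarrow> (point \<Rightarrow> real) \<Rightarrow> point \<Rightarrow> real" where
  "wderiv n \<Omega> is u = (SOME v. v \<in> L2 n \<Omega> \<and> weak_deriv n \<Omega> is u v)"

definition H1_norm :: "nat \<Rightarrow> point set \<Rightarrow> (point \<Rightarrow> real) \<Rightarrow> real" where
  "H1_norm n \<Omega> u = sqrt ((\<integral>x. (u x)\<^sup>2 \<partial>vol_on n \<Omega>) +
     (\<Sum>i<n. \<integral>x. (wderiv n \<Omega> [i] u x)\<^sup>2 \<partial>vol_on n \<Omega>))"

definition H1_0 :: "nat \<Rightarrow> point set \<Rightarrow> (point \<Rightarrow> real) set" where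
  "H1_0 n \<Omega> = {u \<in> H n 1 \<Omega>. \<exists>\<eta> :: nat \<Rightarrow> point \<Rightarrow> real.
     (\<forall>m. test_function n \<Omega> (\<eta> m)) \<and> (\<lambda>m. H1_norm n \<Omega> (\<lambda>x. u x - \<eta> m x)) \<longlonglongrightarrow> 0}"


subsection \<open>The variational problem\<close>

definition laplacian :: "nat \<Rightarrow> point set \<Rightarrow> (point \<Rightarrow> real) \<Rightarrow> point \<Rightarrow> real" where
  "laplacian n \<Omega> u x = (\<Sum>i<n. wderiv n \<Omega> [i, i] u x)"

definition F :: "nat \<Rightarrow> point set \<Rightarrow> (point \<Rightarrow> real) \<Rightarrow> real" where
  "F n \<Omega> u = (\<integral>x. \<bar>laplacian n \<Omega> u x\<bar>\<^sup>2 + indicator {x \<in> \<Omega>. u x \<noteq> 0} x \<partial>vol_on n \<Omega>)"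

definition navier :: "nat \<Rightarrow> point set \<Rightarrow> (point \<Rightarrow> real) \<Rightarrow> (point \<Rightarrow> real) set" where
  "navier n \<Omega> \<phi> = {v \<in> H n 2 \<Omega>. (\<lambda>x. v x - \<phi> x) \<in> H1_0 n \<Omega>}"

definition minimiser :: "nat \<Rightarrow> point set \<Rightarrow> (point \<Rightarrow> real) \<Rightarrow> (point \<Rightarrow> real) \<Rightarrow> bool" where
  "minimiser n \<Omega> \<phi> u \<longleftrightarrow> is_arg_min (F n \<Omega>) (\<lambda>v. v \<in> navier n \<Omega> \<phi>) u"

text \<open>As \<open>u\<close> stands for a class modulo null sets, it lies in \<open>C\<^sup>k\<close> if it has a \<open>C\<^sup>k\<close>
  representative.\<close>

definition lies_in_C_k :: "nat \<Rightarrow> nat \<Rightarrow> point set \<Rightarrow> (point \<Rightarrow> real) \<Rightarrow> bool" where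
  "lies_in_C_k n k \<Omega> u \<longleftrightarrow> (\<exists>w. C_k n k \<Omega> w \<and> (AE x in vol_on n \<Omega>. u x = w x))"

end

theory Submission
  imports Defs "HOL-Computational_Algebra.Polynomial"
begin

text \<open>
  Dimension one is enough. There the functional is the bending energy of a beam on \<open>(-1, 1)\<close>, plus
  the length of the part of the beam that is off the ground.

  The boundary values are \<open>0\<close> at \<open>-1\<close> and \<open>1/3\<close> at \<open>1\<close>. The admissible function that vanishes on
  \<open>(-1, 0]\<close> and equals \<open>x\<^sup>2/2 - x^3/6\<close> on \<open>(0, 1)\<close> has energy \<open>4/3\<close> (\<open>F_competitor\<close>,
  \<open>competitor_in_navier\<close>). Its second derivative jumps from \<open>0\<close> to \<open>1\<close> at \<open>0\<close>, and such a jump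
  is the price of reaching this energy: every admissible \<open>C\<^sup>2\<close> function has energy strictly above
  \<open>4/3\<close> (\<open>C2_in_navier_energy_gt\<close>), so none of them is a minimiser.

  To see this, let \<open>f\<close> be \<open>C\<^sup>2\<close> with zero set \<open>Z\<close>. If \<open>Z\<close> does not accumulate inside the interval,
  it is countable and \<open>f\<close> pays the full length \<open>2\<close>. Otherwise let \<open>p\<close> be the largest accumulation
  point. By Rolle's theorem the zeros of \<open>f'\<close> accumulate at \<open>p\<close> as well, so \<open>f\<close>, \<open>f'\<close> and
  \<open>f''\<close> vanish at \<open>p\<close>. With \<open>L = 1 - p\<close>, the function \<open>f\<close> pays the length \<open>L\<close> on \<open>(p, 1)\<close>, and expanding
  the square of \<open>f'' - (1 - t)/L^3\<close> shows that its bending energy there is at least \<open>1/(3L^3)\<close>, with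
  equality only for \<open>f''(t) = (1 - t)/L^3\<close>. That function does not vanish at \<open>p\<close> and \<open>f''\<close> is
  continuous, hence the inequality is strict, and \<open>L + 1/(3L^3) \<ge> 4/3\<close> finishes the argument (\<open>C2_energy_gt\<close>).

  The rest is Sobolev theory on the interval. Weak derivatives are unique by the fundamental lemma of
  the calculus of variations (\<open>fundamental_lemma\<close>), so they may be computed classically. Membership
  of the competitor in the admissible class needs an explicit sequence of test functions, and the
  boundary value of an admissible function is recovered from the sup-norm bound \<open>sup_bound_H1\<close>.
\<close>

section \<open>Flat functions and an algebra of smooth functions\<close>

text \<open>
  The functions \<open>p(1/x) exp(-1/x)\<close> on the positive axis, extended by \<open>0\<close>. This family is closed
  under differentiation, which reduces the smoothness of \<open>exp(-1/x)\<close> at \<open>0\<close> to a single first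
  derivative.
\<close>

definition flat :: "real poly \<Rightarrow> real \<Rightarrow> real" where
  "flat p x = (if x > 0 then poly p (1 / x) * exp (- (1 / x)) else 0)"

lemma poly_times_exp_tendsto_0:
  fixes p :: "real poly"
  shows "((\<lambda>y. poly p y * exp (- y)) \<longlongrightarrow> 0) at_top"
proof -
  have "((\<lambda>y. \<Sum>i\<le>degree p. coeff p i * (y ^ i / exp y)) \<longlongrightarrow> (\<Sum>i\<le>degree p. coeff p i * 0)) at_top"
    by (intro tendsto_intros tendsto_power_div_exp_0)
  then show ?thesis
    by (simp add: poly_altdef sum_distrib_right exp_minus divide_inverse mult.assoc)
qed

lemma flat_tendsto_0_at_right: "(flat p \<longlongrightarrow> 0) (at_right 0)"
proof -
  have "((\<lambda>x. poly p (inverse x) * exp (- inverse x)) \<longlongrightarrow> 0) (at_right 0)"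
    by (rule filterlim_compose[OF poly_times_exp_tendsto_0 filterlim_inverse_at_top_right])
  moreover have "eventually (\<lambda>x. poly p (inverse x) * exp (- inverse x) = flat p x) (at_right 0)"
    by (simp add: eventually_at_right_field flat_def inverse_eq_divide) (meson zero_less_one)
  ultimately show ?thesis by (rule Lim_transform_eventually)
qed

text \<open>
  The polynomial \<open>x\<^sup>2 (p - p')\<close>: differentiating \<open>p(1/x) exp(-1/x)\<close> produces the inner derivative
  \<open>-1/x\<^sup>2\<close> once from each factor.
\<close>

definition flat_step :: "real poly \<Rightarrow> real poly" where
  "flat_step p = [:0, 0, 1:] * (p - pderiv p)"

lemma flat_has_derivative:
  "(flat p has_real_derivative flat (flat_step p) x) (at x)"
proof -
  consider "x > 0" | "x < 0" | "x = 0" by linarith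
  then show ?thesis
  proof cases
    case 1
    have "((\<lambda>x. poly p (1 / x) * exp (- (1 / x))) has_real_derivative flat (flat_step p) x) (at x)"
      using 1 unfolding flat_step_def flat_def
      by (auto intro!: derivative_eq_intros DERIV_chain2[OF poly_DERIV]
          simp: field_simps power2_eq_square)
    then show ?thesis
      by (rule DERIV_cong_ev[THEN iffD1, rotated -1, OF _ refl _ refl])
         (auto simp: flat_def eventually_nhds intro!: exI[of _ "{0<..}"] 1)
  next
    case 2
    have "((\<lambda>x. 0) has_real_derivative flat (flat_step p) x) (at x)"
      using 2 by (auto simp: flat_def)
    then show ?thesis
      by (rule DERIV_cong_ev[THEN iffD1, rotated -1, OF _ refl _ refl])
         (auto simp: flat_def eventually_nhds intro!: exI[of _ "{..<0}"] 2)
  next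
    case 3
    (* Dividing by y multiplies p by the indeterminate, so the quotient is again a flat function. *)
    have "((\<lambda>y. flat p y / y) \<longlongrightarrow> 0) (at_right 0)"
    proof (rule Lim_transform_eventually[OF flat_tendsto_0_at_right[of "[:0,1:] * p"]])
      show "\<forall>\<^sub>F x in at_right 0. flat ([:0,1:] * p) x = flat p x / x"
        by (auto simp: flat_def)
    qed
    moreover have "((\<lambda>y. flat p y / y) \<longlongrightarrow> 0) (at_left 0)"
      by (rule Lim_transform_eventually[OF tendsto_const])
         (auto simp: flat_def eventually_at_left_field intro!: exI[of _ "-1"])
    ultimately have "((\<lambda>y. flat p y / y) \<longlongrightarrow> 0) (at 0)"
      by (simp add: filterlim_split_at)
    then show ?thesis
      using 3 by (simp add: has_field_derivative_iff flat_def)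
  qed
qed

text \<open>
  All smooth functions below are built from affinely rescaled flat functions by sums and products. As
  the derivative of each generator lies in the algebra again, iterated derivatives exist without any
  formula for them.
\<close>

inductive_set smooth_alg :: "(real \<Rightarrow> real) set" where
  const: "(\<lambda>_. c) \<in> smooth_alg"
| ident: "(\<lambda>x. x) \<in> smooth_alg"
| flat: "(\<lambda>x. flat p (a * x + b)) \<in> smooth_alg"
| add: "f \<in> smooth_alg \<Longrightarrow> g \<in> smooth_alg \<Longrightarrow> (\<lambda>x. f x + g x) \<in> smooth_alg"
| mult: "f \<in> smooth_alg \<Longrightarrow> g \<in> smooth_alg \<Longrightarrow> (\<lambda>x. f x * g x) \<in> smooth_alg"

lemma smooth_alg_has_derivative:
  assumes "f \<in> smooth_alg"
  shows "\<exists>f'\<in>smooth_alg. \<forall>x. (f has_real_derivative f' x) (at x)"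
  using assms
proof induction
  case (const c)
  show ?case by (rule bexI[OF _ smooth_alg.const[of 0]]) auto
next
  case ident
  show ?case by (rule bexI[OF _ smooth_alg.const[of 1]]) auto
next
  case (flat p a b)
  show ?case
  proof (rule bexI)
    show "\<forall>x. ((\<lambda>x. flat p (a * x + b)) has_real_derivative a * flat (flat_step p) (a * x + b)) (at x)"
    proof
      fix x
      have "((\<lambda>x. a * x + b) has_real_derivative a) (at x)"
        by (auto intro!: derivative_eq_intros)
      from DERIV_chain2[OF flat_has_derivative this, of p]
      show "((\<lambda>x. flat p (a * x + b)) has_real_derivative a * flat (flat_step p) (a * x + b)) (at x)"
        by (simp add: mult.commute)
    qed
    show "(\<lambda>x. a * flat (flat_step p) (a * x + b)) \<in> smooth_alg"
      by (intro smooth_alg.intros)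
  qed
next
  case (add f g)
  then obtain f' g' where "f' \<in> smooth_alg" "\<forall>x. (f has_real_derivative f' x) (at x)"
    "g' \<in> smooth_alg" "\<forall>x. (g has_real_derivative g' x) (at x)" by auto
  then show ?case
    by (intro bexI[of _ "\<lambda>x. f' x + g' x"]) (auto intro: smooth_alg.intros derivative_intros)
next
  case (mult f g)
  then obtain f' g' where "f' \<in> smooth_alg" "\<forall>x. (f has_real_derivative f' x) (at x)"
    "g' \<in> smooth_alg" "\<forall>x. (g has_real_derivative g' x) (at x)" by auto
  with mult.hyps show ?case
    by (intro bexI[of _ "\<lambda>x. f' x * g x + g' x * f x"])
       (auto intro!: smooth_alg.intros DERIV_mult)
qed

lemma smooth_alg_deriv: "f \<in> smooth_alg \<Longrightarrow> deriv f \<in> smooth_alg"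
proof -
  assume "f \<in> smooth_alg"
  then obtain f' where f': "f' \<in> smooth_alg" "\<forall>x. (f has_real_derivative f' x) (at x)"
    using smooth_alg_has_derivative by blast
  then have "deriv f = f'" by (auto intro: DERIV_imp_deriv)
  with f' show ?thesis by simp
qed

lemma smooth_alg_iterated_deriv: "f \<in> smooth_alg \<Longrightarrow> (deriv ^^ k) f \<in> smooth_alg"
  by (induction k) (auto intro: smooth_alg_deriv)

lemma smooth_alg_differentiable: "f \<in> smooth_alg \<Longrightarrow> f differentiable (at x)"
  using smooth_alg_has_derivative real_differentiable_def by blast

lemma smooth_alg_continuous_on: "f \<in> smooth_alg \<Longrightarrow> continuous_on A f"
  by (meson smooth_alg_differentiable continuous_at_imp_continuous_on differentiable_imp_continuous_within)

section \<open>The unit ball of dimension one\<close>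

text \<open>
  The terms \<open>unit_ball 1\<close> and \<open>vol_on 1\<close> occur throughout, so \<open>1\<close> must survive simplification.
\<close>

declare One_nat_def [simp del]

lemma lessThan_1: "{..<1} = {0::nat}" by auto

abbreviation I :: "real set" where "I \<equiv> {-1<..<1}"
abbreviation B :: "point set" where "B \<equiv> unit_ball 1"
abbreviation lebI :: "real measure" where "lebI \<equiv> restrict_space lborel I"

text \<open>
  The point of one-dimensional space with coordinate \<open>t\<close>; its inverse is \<open>\<lambda>x. x 0\<close>. Composition with
  the two translates every notion on the ball into one on the interval.
\<close>

definition pt :: "real \<Rightarrow> point" where "pt t = (\<lambda>i\<in>{..<1}. t)"

lemma pt_0 [simp]: "pt t 0 = t"
  by (simp add: pt_def)

lemma pt_update [simp]: "(pt t)(0 := s) = pt s"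
  by (auto simp: pt_def)

lemma pt_coordinate: "x \<in> {..<1} \<rightarrow>\<^sub>E UNIV \<Longrightarrow> pt (x 0) = x"
  by (auto simp: pt_def PiE_def extensional_def)

lemma unit_ball_1: "B = pt ` I"
proof -
  have 1: "x 0 \<in> I" "x = pt (x 0)" if "x \<in> B" for x
  proof -
    have "sqrt ((x 0)\<^sup>2) < 1" using that by (simp add: unit_ball_def L2_set_def lessThan_1)
    then show "x 0 \<in> I" by (simp only: real_sqrt_abs greaterThanLessThan_iff) linarith
    show "x = pt (x 0)" using that by (intro pt_coordinate[symmetric]) (simp add: unit_ball_def)
  qed
  have 2: "pt t \<in> B" if "t \<in> I" for t
  proof -
    have "sqrt (t\<^sup>2) < 1" using that by (simp only: real_sqrt_abs greaterThanLessThan_iff) linarith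
    then show ?thesis by (simp add: unit_ball_def L2_set_def lessThan_1 pt_def)
  qed
  show ?thesis using 1 2 by blast
qed

lemma continuous_on_pt: "continuous_on A pt"
proof (rule continuous_on_coordinatewise_then_product)
  fix i show "continuous_on A (\<lambda>t. pt t i)"
    by (cases "i < 1") (simp_all add: pt_def)
qed

lemma continuous_on_coord: "continuous_on A (\<lambda>x::point. x 0)"
  by (rule continuous_on_product_then_coordinatewise) (rule continuous_on_id)

lemma continuous_on_ball_iff: "continuous_on B f \<longleftrightarrow> continuous_on I (f \<circ> pt)"
proof
  assume "continuous_on B f"
  then show "continuous_on I (f \<circ> pt)"
    unfolding unit_ball_1 by (rule continuous_on_compose[OF continuous_on_pt])
next
  assume *: "continuous_on I (f \<circ> pt)"
  have "continuous_on B (\<lambda>x. (f \<circ> pt) (x 0))"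
    by (rule continuous_on_compose2[OF * continuous_on_coord]) (auto simp: unit_ball_1)
  moreover have "(f \<circ> pt) (x 0) = f x" if "x \<in> B" for x
    using that by (auto simp: unit_ball_1)
  ultimately show "continuous_on B f" by (simp cong: continuous_on_cong)
qed

lemma partial_deriv_pt: "partial_deriv 0 f \<circ> pt = deriv (f \<circ> pt)"
  by (auto simp: partial_deriv_def o_def)

lemma partials_pt: "partials (replicate k 0) f \<circ> pt = (deriv ^^ k) (f \<circ> pt)"
proof (induction k)
  case (Suc k)
  have "partials (replicate (Suc k) 0) f = partial_deriv 0 (partials (replicate k 0) f)"
    by (simp add: partials_def)
  then show ?case by (simp only: partial_deriv_pt Suc.IH funpow.simps o_apply)
qed (simp add: partials_def)

lemma partials_lift: "partials (replicate k 0) (\<lambda>x. f (x 0)) = (\<lambda>x. (deriv ^^ k) f (x 0))"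
  by (induction k) (simp_all add: partials_def partial_deriv_def)

lemma C_k_ball_iff:
  "C_k 1 k B f \<longleftrightarrow> (\<forall>j\<le>k. continuous_on I ((deriv ^^ j) (f \<circ> pt))) \<and>
     (\<forall>j<k. \<forall>t\<in>I. (deriv ^^ j) (f \<circ> pt) differentiable (at t))"
proof (induction k arbitrary: f)
  case 0
  show ?case by (simp add: continuous_on_ball_iff)
next
  case (Suc k)
  have "(\<forall>x\<in>B. (\<lambda>t. f (x(0 := t))) differentiable (at (x 0))) \<longleftrightarrow>
        (\<forall>t\<in>I. (f \<circ> pt) differentiable (at t))"
    by (simp add: unit_ball_1 o_def)
  then have "C_k 1 (Suc k) B f \<longleftrightarrow> continuous_on I (f \<circ> pt) \<and>
      (\<forall>t\<in>I. (f \<circ> pt) differentiable (at t)) \<and>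
      (\<forall>j\<le>k. continuous_on I ((deriv ^^ Suc j) (f \<circ> pt))) \<and>
      (\<forall>j<k. \<forall>t\<in>I. (deriv ^^ Suc j) (f \<circ> pt) differentiable (at t))"
    by (simp add: Suc.IH partial_deriv_pt continuous_on_ball_iff funpow_Suc_right del: funpow.simps)
  moreover have "(\<forall>j\<le>Suc k. P j) \<longleftrightarrow> P 0 \<and> (\<forall>j\<le>k. P (Suc j))" for P
    using All_less_Suc2[of "Suc k" P] by (simp only: less_Suc_eq_le)
  ultimately show ?case
    unfolding All_less_Suc2[of k] by (simp only: funpow_0) blast
qed

text \<open>
  The functions \<open>\<eta> \<circ> pt\<close> for test functions \<open>\<eta>\<close> on the ball.
\<close>

definition test_I :: "(real \<Rightarrow> real) \<Rightarrow> bool" where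
  "test_I g \<longleftrightarrow> (\<forall>k. \<forall>t\<in>I. (deriv ^^ k) g differentiable (at t)) \<and>
     (\<exists>r\<in>{0<..<1}. \<forall>t\<in>I. r < \<bar>t\<bar> \<longrightarrow> g t = 0)"

lemma test_function_iff: "test_function 1 B \<eta> \<longleftrightarrow> test_I (\<eta> \<circ> pt)"
proof -
  have smooth: "C_infinity 1 B \<eta> \<longleftrightarrow> (\<forall>k. \<forall>t\<in>I. (deriv ^^ k) (\<eta> \<circ> pt) differentiable (at t))"
    unfolding C_infinity_def C_k_ball_iff
    by (metis continuous_at_imp_continuous_on differentiable_imp_continuous_within lessI)
  have "(\<exists>K. compact K \<and> K \<subseteq> B \<and> (\<forall>x\<in>B - K. \<eta> x = 0)) \<longleftrightarrow>
     (\<exists>r\<in>{0<..<1}. \<forall>t\<in>I. r < \<bar>t\<bar> \<longrightarrow> (\<eta> \<circ> pt) t = 0)" (is "?L \<longleftrightarrow> ?R")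
  proof
    assume ?L
    then obtain K where K: "compact K" "K \<subseteq> B" "\<forall>x\<in>B - K. \<eta> x = 0" by auto
    have "compact ((\<lambda>x. \<bar>x 0\<bar>) ` K)"
      by (intro compact_continuous_image K continuous_intros continuous_on_coord)
    show ?R
    proof (cases "K = {}")
      case True
      with K show ?thesis by (intro bexI[of _ "1/2"]) (auto simp: unit_ball_1)
    next
      case False
      obtain s where s: "s \<in> (\<lambda>x. \<bar>x 0\<bar>) ` K" "\<forall>t\<in>(\<lambda>x. \<bar>x 0\<bar>) ` K. t \<le> s"
        using compact_attains_sup[of "(\<lambda>x. \<bar>x 0\<bar>) ` K"] \<open>compact ((\<lambda>x. \<bar>x 0\<bar>) ` K)\<close> False by auto
      from s(1) K(2) have s1: "0 \<le> s" "s < 1" by (auto simp: unit_ball_1 dest!: subsetD)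
      have "(\<eta> \<circ> pt) t = 0" if "t \<in> I" "(s + 1) / 2 < \<bar>t\<bar>" for t
      proof -
        have "pt t \<notin> K"
        proof
          assume "pt t \<in> K"
          then have "\<bar>t\<bar> \<le> s" using s(2) by force
          with that(2) s1 show False by (simp add: field_simps)
        qed
        with K(3) that show ?thesis by (auto simp: unit_ball_1)
      qed
      with s1 show ?thesis by (intro bexI[of _ "(s + 1) / 2"]) auto
    qed
  next
    assume ?R
    then obtain r where r: "0 < r" "r < 1" "\<And>t. t \<in> I \<Longrightarrow> r < \<bar>t\<bar> \<Longrightarrow> (\<eta> \<circ> pt) t = 0" by auto
    show ?L
    proof (intro exI[of _ "pt ` {-r..r}"] conjI)
      show "compact (pt ` {-r..r})"
        by (intro compact_continuous_image continuous_on_pt compact_Icc)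
      show "pt ` {-r..r} \<subseteq> B" using r by (auto simp: unit_ball_1)
      show "\<forall>x\<in>B - pt ` {-r..r}. \<eta> x = 0"
      proof
        fix x assume x: "x \<in> B - pt ` {-r..r}"
        then obtain t where t: "t \<in> I" "x = pt t" by (auto simp: unit_ball_1)
        with x have "t \<notin> {-r..r}" by auto
        with t r(3)[of t] show "\<eta> x = 0" by auto
      qed
    qed
  qed
  with smooth show ?thesis unfolding test_function_def test_I_def by simp
qed

lemma measurable_pt [measurable]: "pt \<in> borel \<rightarrow>\<^sub>M (\<Pi>\<^sub>M i\<in>{..<1}. lborel)"
  unfolding pt_def by (rule measurable_restrict) auto

lemma sets_unit_ball_1: "B \<in> sets (\<Pi>\<^sub>M i\<in>{..<1::nat}. (lborel :: real measure))"
proof -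
  have "B = (\<lambda>x. x 0) -` I \<inter> space (\<Pi>\<^sub>M i\<in>{..<1::nat}. (lborel :: real measure))"
  proof (intro set_eqI iffI)
    fix x assume "x \<in> B"
    then show "x \<in> (\<lambda>x. x 0) -` I \<inter> space (\<Pi>\<^sub>M i\<in>{..<1::nat}. (lborel :: real measure))"
      by (simp add: unit_ball_1 space_PiM lessThan_1) (auto simp: pt_def PiE_iff extensional_def)
  next
    fix x assume x: "x \<in> (\<lambda>x. x 0) -` I \<inter> space (\<Pi>\<^sub>M i\<in>{..<1::nat}. (lborel :: real measure))"
    then have "x = pt (x 0)" by (intro pt_coordinate[symmetric]) (simp add: space_PiM)
    with x show "x \<in> B" unfolding unit_ball_1 by blast
  qed
  also have "\<dots> \<in> sets (\<Pi>\<^sub>M i\<in>{..<1::nat}. (lborel :: real measure))"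
    by (rule measurable_sets[OF measurable_component_singleton]) auto
  finally show ?thesis .
qed

lemma space_vol_on_1: "space (vol_on 1 B) = B"
  by (auto simp: vol_on_def space_restrict_space space_PiM unit_ball_def)

lemma measurable_pt_ball [measurable]: "pt \<in> lebI \<rightarrow>\<^sub>M vol_on 1 B"
  unfolding vol_on_def
  by (rule measurable_restrict_space3[where A = I]) (auto simp: unit_ball_1 intro: measurable_pt)

lemma measurable_coord_ball [measurable]: "(\<lambda>x. x 0) \<in> vol_on 1 B \<rightarrow>\<^sub>M lebI"
  unfolding vol_on_def
  by (rule measurable_restrict_space3[where A = B])
     (auto simp: unit_ball_1 intro: measurable_component_singleton)

text \<open>
  The product of a single copy of Lebesgue measure is Lebesgue measure, carried over by \<open>pt\<close>. From
  this identity the translations of measurability, integrability and integrals follow.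
\<close>

lemma vol_on_1_eq_distr: "vol_on 1 B = distr lebI (vol_on 1 B) pt"
proof (rule measure_eqI)
  fix A assume "A \<in> sets (vol_on 1 B)"
  then have A: "A \<in> sets (\<Pi>\<^sub>M i\<in>{..<1::nat}. (lborel :: real measure))" "A \<subseteq> B"
    using sets_unit_ball_1 by (simp_all add: vol_on_def sets_restrict_space_iff sets.Int_space_eq2)
  interpret product_sigma_finite "\<lambda>_::nat. lborel :: real measure" ..
  have "pt -` A \<in> sets borel"
    using measurable_sets[OF measurable_pt A(1)] by simp
  have "pt -` A \<subseteq> I" using A(2) by (auto simp: unit_ball_1 dest!: subsetD) (metis pt_0)+
  have "A = (\<lambda>x. x 0) -` (pt -` A) \<inter> space (\<Pi>\<^sub>M i\<in>{0::nat}. (lborel :: real measure))"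
  proof -
    have "pt (x 0) = x" if "x \<in> A \<or> x \<in> space (\<Pi>\<^sub>M i\<in>{0::nat}. (lborel :: real measure))" for x
      using that A(2) by (auto simp: unit_ball_def space_PiM lessThan_1 intro!: pt_coordinate)
    moreover have "A \<subseteq> space (\<Pi>\<^sub>M i\<in>{0::nat}. (lborel :: real measure))"
      using A(2) by (auto simp: space_PiM unit_ball_def lessThan_1)
    ultimately show ?thesis by auto
  qed
  then have "emeasure (\<Pi>\<^sub>M i\<in>{0::nat}. lborel) A =
      emeasure (distr (\<Pi>\<^sub>M i\<in>{0::nat}. lborel) lborel (\<lambda>x. x 0)) (pt -` A)"
    using \<open>pt -` A \<in> sets borel\<close> by (subst emeasure_distr) (auto intro: measurable_component_singleton)
  also have "\<dots> = emeasure lborel (pt -` A)" by (simp add: distr_singleton)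
  finally have *: "emeasure (\<Pi>\<^sub>M i\<in>{0::nat}. lborel) A = emeasure lborel (pt -` A)" .
  have "{..<1::nat} = {0}" by auto
  then have "emeasure (vol_on 1 B) A = emeasure (\<Pi>\<^sub>M i\<in>{0::nat}. lborel) A"
    using A sets_unit_ball_1 by (simp add: vol_on_def emeasure_restrict_space)
  also have "\<dots> = emeasure lebI (pt -` A \<inter> I)"
    using * \<open>pt -` A \<subseteq> I\<close> by (simp add: emeasure_restrict_space Int_absorb2)
  also have "\<dots> = emeasure (distr lebI (vol_on 1 B) pt) A"
    using \<open>A \<in> sets (vol_on 1 B)\<close> by (simp add: emeasure_distr space_restrict_space)
  finally show "emeasure (vol_on 1 B) A = emeasure (distr lebI (vol_on 1 B) pt) A" .
qed simp

lemma borel_measurable_ball_iff: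
  "f \<in> borel_measurable (vol_on 1 B) \<longleftrightarrow> f \<circ> pt \<in> borel_measurable lebI"
proof
  assume "f \<in> borel_measurable (vol_on 1 B)"
  then show "f \<circ> pt \<in> borel_measurable lebI" by measurable
next
  assume "f \<circ> pt \<in> borel_measurable lebI"
  then have "(\<lambda>x. (f \<circ> pt) (x 0)) \<in> borel_measurable (vol_on 1 B)"
    by (rule measurable_compose[OF measurable_coord_ball])
  also have "?this \<longleftrightarrow> f \<in> borel_measurable (vol_on 1 B)"
    by (rule measurable_cong) (unfold space_vol_on_1, auto simp: unit_ball_1)
  finally show "f \<in> borel_measurable (vol_on 1 B)" .
qed

lemma integrable_ball_iff:
  fixes f :: "point \<Rightarrow> real"
  shows "integrable (vol_on 1 B) f \<longleftrightarrow> integrable lebI (f \<circ> pt)"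
proof (cases "f \<in> borel_measurable (vol_on 1 B)")
  case True
  then have "integrable (distr lebI (vol_on 1 B) pt) f \<longleftrightarrow> integrable lebI (\<lambda>t. f (pt t))"
    by (rule integrable_distr_eq[OF measurable_pt_ball])
  then show ?thesis by (simp add: vol_on_1_eq_distr[symmetric] o_def)
next
  case False
  then show ?thesis using borel_measurable_ball_iff borel_measurable_integrable by blast
qed

lemma integral_ball_eq:
  fixes f :: "point \<Rightarrow> real"
  shows "integral\<^sup>L (vol_on 1 B) f = integral\<^sup>L lebI (f \<circ> pt)"
proof (cases "f \<in> borel_measurable (vol_on 1 B)")
  case True
  then have "integral\<^sup>L (distr lebI (vol_on 1 B) pt) f = integral\<^sup>L lebI (\<lambda>t. f (pt t))"
    by (rule integral_distr[OF measurable_pt_ball])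
  then show ?thesis by (simp add: vol_on_1_eq_distr[symmetric] o_def)
next
  case False
  then show ?thesis
    using borel_measurable_ball_iff borel_measurable_integrable not_integrable_integral_eq by metis
qed

lemma AE_ball_D: "(AE x in vol_on 1 B. P x) \<Longrightarrow> (AE t in lebI. P (pt t))"
  by (metis AE_distrD[OF measurable_pt_ball] vol_on_1_eq_distr)

section \<open>Square-integrable functions on the interval\<close>

lemma integrable_lebI_iff:
  fixes f :: "real \<Rightarrow> real"
  shows "integrable lebI f \<longleftrightarrow> set_integrable lborel I f"
  by (simp add: integrable_restrict_space set_integrable_def)

lemma integral_lebI_eq:
  fixes f :: "real \<Rightarrow> real"
  shows "integral\<^sup>L lebI f = (LINT t:I|lborel. f t)"
  by (simp add: integral_restrict_space set_lebesgue_integral_def)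

lemma AE_lebI_iff: "(AE t in lebI. P t) \<longleftrightarrow> (AE t in lborel. t \<in> I \<longrightarrow> P t)"
  by (simp add: AE_restrict_space_iff)

lemma space_lebI [simp]: "space lebI = I"
  by (simp add: space_restrict_space)

lemma finite_measure_lebI: "finite_measure lebI"
  by (rule finite_measureI) (simp add: emeasure_restrict_space)

lemma measure_lebI_space: "measure lebI I = 2"
  by (simp add: measure_restrict_space)

lemma continuous_on_I_measurable: "continuous_on I f \<Longrightarrow> f \<in> borel_measurable lebI"
  by (subst measurable_cong_sets[OF sets_restrict_space_cong[OF sets_lborel] refl])
     (rule borel_measurable_continuous_on_restrict)

definition L2I :: "(real \<Rightarrow> real) set" where
  "L2I = {u \<in> borel_measurable lebI. integrable lebI (\<lambda>t. (u t)\<^sup>2)}"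

lemma L2I_integrable_mult:
  assumes "u \<in> L2I" "v \<in> L2I"
  shows "integrable lebI (\<lambda>t. u t * v t)"
proof (rule Bochner_Integration.integrable_bound)
  show "integrable lebI (\<lambda>t. (u t)\<^sup>2 + (v t)\<^sup>2)" using assms by (auto simp: L2I_def)
  show "(\<lambda>t. u t * v t) \<in> borel_measurable lebI"
    using assms by (auto simp: L2I_def intro!: borel_measurable_times)
  have "\<bar>x * y\<bar> \<le> x\<^sup>2 + y\<^sup>2" for x y :: real
  proof -
    have "2 * (\<bar>x\<bar> * \<bar>y\<bar>) \<le> x\<^sup>2 + y\<^sup>2" "0 \<le> \<bar>x\<bar> * \<bar>y\<bar>"
      using sum_squares_bound[of "\<bar>x\<bar>" "\<bar>y\<bar>"] by simp_all
    then show ?thesis unfolding abs_mult by linarith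
  qed
  then show "AE t in lebI. norm (u t * v t) \<le> norm ((u t)\<^sup>2 + (v t)\<^sup>2)"
    by (auto intro!: AE_I2)
qed

lemma L2I_const: "(\<lambda>_. c) \<in> L2I"
  using finite_measure.integrable_const[OF finite_measure_lebI] by (simp add: L2I_def)

lemma L2I_integrable: "u \<in> L2I \<Longrightarrow> integrable lebI u"
  using L2I_integrable_mult[OF _ L2I_const[of 1]] by simp

lemma L2I_cmult: "u \<in> L2I \<Longrightarrow> (\<lambda>t. c * u t) \<in> L2I"
  by (auto simp: L2I_def power_mult_distrib)

lemma L2I_add:
  assumes "u \<in> L2I" "v \<in> L2I" shows "(\<lambda>t. u t + v t) \<in> L2I"
proof -
  have "integrable lebI (\<lambda>t. (u t)\<^sup>2 + 2 * (u t * v t) + (v t)\<^sup>2)"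
    using assms L2I_integrable_mult[OF assms] by (auto simp: L2I_def)
  then have "integrable lebI (\<lambda>t. (u t + v t)\<^sup>2)"
    by (simp add: power2_sum algebra_simps)
  with assms show ?thesis by (auto simp: L2I_def)
qed

lemma L2I_diff: "u \<in> L2I \<Longrightarrow> v \<in> L2I \<Longrightarrow> (\<lambda>t. u t - v t) \<in> L2I"
  using L2I_add[OF _ L2I_cmult[of v "-1"]] by simp

lemma L2I_bounded:
  assumes "f \<in> borel_measurable lebI" "\<And>t. t \<in> I \<Longrightarrow> \<bar>f t\<bar> \<le> C"
  shows "f \<in> L2I"
proof -
  have "integrable lebI (\<lambda>t. (f t)\<^sup>2)"
  proof (rule finite_measure.integrable_const_bound[OF finite_measure_lebI])
    show "AE t in lebI. norm ((f t)\<^sup>2) \<le> C\<^sup>2"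
      using assms(2) by (auto intro!: AE_I2 abs_le_square_iff[THEN iffD1] order_trans[OF _ abs_ge_self])
    show "(\<lambda>t. (f t)\<^sup>2) \<in> borel_measurable lebI" using assms(1) by simp
  qed
  with assms(1) show ?thesis by (simp add: L2I_def)
qed

lemma L2I_continuous:
  assumes "continuous_on {-1..1} f" shows "f \<in> L2I"
proof -
  have "bounded (f ` {-1..1})"
    using assms by (intro compact_imp_bounded compact_continuous_image) auto
  then obtain C where "\<forall>t\<in>{-1..1}. \<bar>f t\<bar> \<le> C" by (auto simp: bounded_iff)
  then show ?thesis
    using assms by (intro L2I_bounded[of _ C] continuous_on_I_measurable)
      (auto intro: continuous_on_subset)
qed

section \<open>Test functions on the interval\<close>

lemma test_I_differentiable: "test_I g \<Longrightarrow> t \<in> I \<Longrightarrow> (deriv ^^ k) g differentiable (at t)"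
  by (simp add: test_I_def)

lemma test_I_DERIV: "test_I g \<Longrightarrow> t \<in> I \<Longrightarrow> (g has_real_derivative deriv g t) (at t)"
  using test_I_differentiable[of g t 0] by (simp add: DERIV_deriv_iff_real_differentiable)

lemma test_I_continuous_on: "test_I g \<Longrightarrow> continuous_on I g"
  by (meson test_I_DERIV DERIV_isCont continuous_at_imp_continuous_on)

lemma deriv_eq_0_if_vanishes:
  assumes "\<And>t. t \<in> I \<Longrightarrow> r < \<bar>t\<bar> \<Longrightarrow> g t = 0" "t \<in> I" "r < \<bar>t\<bar>"
  shows "(g has_real_derivative 0) (at t)"
proof -
  have "open (I \<inter> {t. r < \<bar>t\<bar>})" by (intro open_Int open_greaterThanLessThan open_Collect_less continuous_intros)
  then have "eventually (\<lambda>s. g s = 0) (nhds t)"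
    unfolding eventually_nhds using assms by (intro exI[of _ "I \<inter> {t. r < \<bar>t\<bar>}"]) auto
  then show ?thesis by (subst DERIV_cong_ev[OF refl _ refl]) auto
qed

lemma test_I_deriv: assumes "test_I g" shows "test_I (deriv g)"
proof -
  from assms obtain r where r: "r \<in> {0<..<1}" "\<And>t. t \<in> I \<Longrightarrow> r < \<bar>t\<bar> \<Longrightarrow> g t = 0"
    by (auto simp: test_I_def)
  have "deriv g t = 0" if "t \<in> I" "r < \<bar>t\<bar>" for t
    using deriv_eq_0_if_vanishes[OF r(2) that] by (auto intro: DERIV_imp_deriv)
  moreover have "(deriv ^^ k) (deriv g) differentiable (at t)" if "t \<in> I" for k t
    using test_I_differentiable[OF assms that, of "Suc k"] by (simp add: funpow_Suc_right del: funpow.simps)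
  ultimately show ?thesis using r(1) unfolding test_I_def by blast
qed

lemma test_I_iterated_deriv: "test_I g \<Longrightarrow> test_I ((deriv ^^ k) g)"
  by (induction k) (auto intro: test_I_deriv)

lemma test_I_bounded:
  assumes "test_I g"
  obtains r C where "0 < r" "r < 1" "\<And>t. t \<in> I \<Longrightarrow> r < \<bar>t\<bar> \<Longrightarrow> g t = 0" "\<And>t. t \<in> I \<Longrightarrow> \<bar>g t\<bar> \<le> C"
proof -
  from assms obtain r where r: "0 < r" "r < 1" "\<And>t. t \<in> I \<Longrightarrow> r < \<bar>t\<bar> \<Longrightarrow> g t = 0"
    by (auto simp: test_I_def)
  have "continuous_on {-r..r} g"
    using r by (intro continuous_on_subset[OF test_I_continuous_on[OF assms]]) auto
  then have "bounded (g ` {-r..r})" by (intro compact_imp_bounded compact_continuous_image) auto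
  then obtain C where C: "\<forall>t\<in>{-r..r}. \<bar>g t\<bar> \<le> C" by (auto simp: bounded_iff)
  have "\<bar>g t\<bar> \<le> max C 0" if "t \<in> I" for t
  proof (cases "r < \<bar>t\<bar>")
    case False
    then have "t \<in> {-r..r}" by auto
    with C show ?thesis by (metis max.coboundedI1)
  qed (simp add: r(3)[OF that])
  with r show thesis using that by blast
qed

lemma test_I_L2I: assumes "test_I g" shows "g \<in> L2I"
proof -
  obtain r C where "\<And>t. t \<in> I \<Longrightarrow> \<bar>g t\<bar> \<le> C"
    using test_I_bounded[OF assms] by metis
  then show ?thesis
    by (intro L2I_bounded[of g C] continuous_on_I_measurable test_I_continuous_on assms)
qed

lemma smooth_alg_test_I:
  assumes "f \<in> smooth_alg" "0 < r" "r < 1" "\<And>t. t \<in> I \<Longrightarrow> r < \<bar>t\<bar> \<Longrightarrow> f t = 0"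
  shows "test_I f"
  unfolding test_I_def
proof (intro conjI allI ballI)
  show "(deriv ^^ k) f differentiable (at t)" for k t
    by (intro smooth_alg_differentiable smooth_alg_iterated_deriv assms)
  show "\<exists>r\<in>{0<..<1}. \<forall>t\<in>I. r < \<bar>t\<bar> \<longrightarrow> f t = 0"
    using assms by (intro bexI[of _ r]) auto
qed

abbreviation flat1 :: "real \<Rightarrow> real" where "flat1 \<equiv> flat 1"

lemma flat1_nonneg: "0 \<le> flat1 x" and flat1_le_1: "flat1 x \<le> 1"
  by (auto simp: flat_def)

lemma flat1_tendsto_1: "(flat1 \<longlongrightarrow> 1) at_top"
proof -
  have "((\<lambda>x::real. exp (- inverse x)) \<longlongrightarrow> exp (- 0)) at_top"
    by (intro tendsto_intros tendsto_inverse_0_at_top filterlim_ident)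
  moreover have "eventually (\<lambda>x. exp (- inverse x) = flat1 x) at_top"
    using eventually_gt_at_top[of 0] by eventually_elim (simp add: flat_def inverse_eq_divide)
  ultimately show ?thesis by (auto intro: Lim_transform_eventually)
qed

lemma filterlim_nat_affine:
  "0 < c \<Longrightarrow> filterlim (\<lambda>m::nat. real m * c + d) at_top sequentially"
  unfolding add.commute[of _ d]
  by (intro filterlim_tendsto_add_at_top[OF tendsto_const]
      filterlim_at_top_mult_tendsto_pos[OF tendsto_const] filterlim_real_sequentially)

lemma flat1_affine_tendsto_1:
  "0 < c \<Longrightarrow> (\<lambda>m. flat1 (real m * c + d)) \<longlonglongrightarrow> 1"
  by (rule filterlim_compose[OF flat1_tendsto_1 filterlim_nat_affine])

section \<open>The fundamental lemma of the calculus of variations\<close>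

text \<open>
  Enough for pairing with test functions, whose supports stay away from the endpoints.
  Square-integrability would be too strong to assume: the classical second derivative of a \<open>C\<^sup>2\<close> function may a priori blow up at the ends,
  and its square-integrability is a consequence of the uniqueness of weak derivatives.
\<close>

definition locally_integrable :: "(real \<Rightarrow> real) \<Rightarrow> bool" where
  "locally_integrable f \<longleftrightarrow> (\<forall>r. 0 < r \<and> r < 1 \<longrightarrow> set_integrable lborel {-r..r} f)"

lemma locally_integrable_continuous: "continuous_on I f \<Longrightarrow> locally_integrable f"
  unfolding locally_integrable_def
  by (auto intro!: borel_integrable_atLeastAtMost' elim!: continuous_on_subset)

lemma locally_integrable_diff:
  "locally_integrable f \<Longrightarrow> locally_integrable g \<Longrightarrow> locally_integrable (\<lambda>t. f t - g t)"
  by (auto simp: locally_integrable_def)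

lemma locally_integrable_L2I: "f \<in> L2I \<Longrightarrow> locally_integrable f"
  using L2I_integrable[of f] unfolding locally_integrable_def integrable_lebI_iff
  by (auto elim!: set_integrable_subset)

lemma locally_integrable_mult_test:
  assumes f: "locally_integrable f" and g: "test_I g"
  shows "integrable lebI (\<lambda>t. f t * g t)"
proof -
  obtain r C where r: "0 < r" "r < 1" "\<And>t. t \<in> I \<Longrightarrow> r < \<bar>t\<bar> \<Longrightarrow> g t = 0"
    and C: "\<And>t. t \<in> I \<Longrightarrow> \<bar>g t\<bar> \<le> C"
    using test_I_bounded[OF g] by blast
  have int: "integrable lborel (\<lambda>t. indicator {-r..r} t *\<^sub>R f t)"
    using f r by (auto simp: locally_integrable_def set_integrable_def)
  have eq: "indicator I t *\<^sub>R (f t * g t) = (indicator {-r..r} t *\<^sub>R f t) * (indicator I t *\<^sub>R g t)" for t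
    using r(3)[of t] r(1,2) by (cases "r < \<bar>t\<bar>") (auto simp: indicator_def)
  have "integrable lborel (\<lambda>t. (indicator {-r..r} t *\<^sub>R f t) * (indicator I t *\<^sub>R g t))"
  proof (rule Bochner_Integration.integrable_bound)
    show "integrable lborel (\<lambda>t. C * (indicator {-r..r} t *\<^sub>R f t))" using int by simp
    have "(\<lambda>t. indicator I t *\<^sub>R g t) \<in> borel_measurable borel"
      by (rule borel_measurable_continuous_on_indicator) (auto intro: test_I_continuous_on[OF g])
    then show "(\<lambda>t. indicator {-r..r} t *\<^sub>R f t * (indicator I t *\<^sub>R g t)) \<in> borel_measurable lborel"
      using borel_measurable_integrable[OF int] by (intro borel_measurable_times) simp_all
    show "AE t in lborel. norm (indicator {-r..r} t *\<^sub>R f t * (indicator I t *\<^sub>R g t))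
        \<le> norm (C * (indicator {-r..r} t *\<^sub>R f t))"
    proof (rule AE_I2)
      fix t
      have "\<bar>indicator I t *\<^sub>R g t\<bar> \<le> \<bar>C\<bar>"
        using C[of t] by (auto simp: indicator_def)
      then show "norm (indicator {-r..r} t *\<^sub>R f t * (indicator I t *\<^sub>R g t))
        \<le> norm (C * (indicator {-r..r} t *\<^sub>R f t))"
        unfolding real_norm_def abs_mult
        by (subst mult.commute[of "\<bar>indicator {-r..r} t *\<^sub>R f t\<bar>"]) (rule mult_right_mono, simp_all only: abs_ge_zero)
    qed
  qed
  then show ?thesis
    unfolding integrable_lebI_iff set_integrable_def eq .
qed

text \<open>
  The products \<open>flat1 (m (t - a)) * flat1 (m (b - t))\<close> are test functions with values in \<open>[0, 1]\<close> that
  converge to the indicator function of \<open>(a, b)\<close>.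
\<close>

lemma fundamental_lemma_interval:
  assumes f: "locally_integrable f" and zero: "\<And>g. test_I g \<Longrightarrow> (\<integral>t. f t * g t \<partial>lebI) = 0"
    and ab: "-1 < a" "b < 1"
  shows "(LINT t:{a<..<b}|lborel. f t) = 0"
proof (cases "a < b")
  case True
  (* A common support [-r, r] on which f is integrable. *)
  define r where "r = max \<bar>a\<bar> \<bar>b\<bar>"
  have r: "0 < r" "r < 1" "-r \<le> a" "b \<le> r" using ab True by (auto simp: r_def)
  define \<eta> where "\<eta> m t = flat1 (real m * t + (- real m * a)) * flat1 ((- real m) * t + real m * b)" for m t
  have \<eta>_outside: "\<eta> m t = 0" if "t \<notin> {a<..<b}" for m t
    using that mult_left_mono[of t a "real m"] mult_left_mono[of b t "real m"]
    by (auto simp: \<eta>_def flat_def not_less)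
  have \<eta>_bound: "0 \<le> \<eta> m t" "\<eta> m t \<le> 1" for m t
    unfolding \<eta>_def by (auto intro!: mult_nonneg_nonneg mult_le_one flat1_nonneg flat1_le_1)
  have \<eta>_test: "test_I (\<eta> m)" for m
  proof (rule smooth_alg_test_I[OF _ r(1,2)])
    show "\<eta> m \<in> smooth_alg" unfolding \<eta>_def by (intro smooth_alg.intros)
    show "\<eta> m t = 0" if "r < \<bar>t\<bar>" for t using that r by (intro \<eta>_outside) auto
  qed
  have \<eta>_lim: "(\<lambda>m. \<eta> m t) \<longlonglongrightarrow> 1" if "t \<in> {a<..<b}" for t
  proof -
    have "(\<lambda>m. flat1 (real m * (t - a) + 0) * flat1 (real m * (b - t) + 0)) \<longlonglongrightarrow> 1 * 1"
      using that by (intro tendsto_mult flat1_affine_tendsto_1) auto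
    then show ?thesis by (simp add: \<eta>_def algebra_simps)
  qed
  have int: "integrable lborel (\<lambda>t. indicator {-r..r} t *\<^sub>R f t)"
    using f r by (auto simp: locally_integrable_def set_integrable_def)
  let ?s = "\<lambda>m t. indicator {-r..r} t *\<^sub>R f t * \<eta> m t"
  have meas: "(\<lambda>t. \<eta> m t) \<in> borel_measurable lborel" for m
  proof -
    have "\<eta> m \<in> smooth_alg" unfolding \<eta>_def by (intro smooth_alg.intros)
    then show ?thesis
      using borel_measurable_continuous_onI[OF smooth_alg_continuous_on, of "\<eta> m"] by simp
  qed
  have "(\<lambda>m. integral\<^sup>L lborel (?s m)) \<longlonglongrightarrow>
      integral\<^sup>L lborel (\<lambda>t. indicator {a<..<b} t *\<^sub>R f t)"
  proof (rule integral_dominated_convergence[where w = "\<lambda>t. \<bar>indicator {-r..r} t *\<^sub>R f t\<bar>"])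
    have "integrable lborel (\<lambda>t. indicator {a<..<b} t *\<^sub>R (indicator {-r..r} t *\<^sub>R f t))"
      by (intro integrable_mult_indicator int) auto
    also have "(\<lambda>t. indicator {a<..<b} t *\<^sub>R (indicator {-r..r} t *\<^sub>R f t)) =
        (\<lambda>t. indicator {a<..<b} t *\<^sub>R f t)"
      using r by (auto simp: indicator_def fun_eq_iff)
    finally show "(\<lambda>t. indicator {a<..<b} t *\<^sub>R f t) \<in> borel_measurable lborel"
      by (rule borel_measurable_integrable)
    show "?s m \<in> borel_measurable lborel" for m
      by (intro borel_measurable_times borel_measurable_integrable[OF int] meas)
    show "integrable lborel (\<lambda>t. \<bar>indicator {-r..r} t *\<^sub>R f t\<bar>)"
      by (rule integrable_abs[OF int])
    show "AE t in lborel. (\<lambda>m. ?s m t) \<longlonglongrightarrow> indicator {a<..<b} t *\<^sub>R f t"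
    proof (rule AE_I2)
      fix t
      show "(\<lambda>m. ?s m t) \<longlonglongrightarrow> indicator {a<..<b} t *\<^sub>R f t"
      proof (cases "t \<in> {a<..<b}")
        case True
        have "(\<lambda>m. ?s m t) \<longlonglongrightarrow> indicator {-r..r} t *\<^sub>R f t * 1"
          by (intro tendsto_intros \<eta>_lim True)
        then show ?thesis using True r by (simp add: indicator_def)
      next
        case False
        then show ?thesis by (simp add: \<eta>_outside)
      qed
    qed
    show "AE t in lborel. norm (?s m t) \<le> \<bar>indicator {-r..r} t *\<^sub>R f t\<bar>" for m
      using \<eta>_bound[of m] by (auto intro!: AE_I2 mult_left_le simp: abs_mult)
  qed
  moreover have "integral\<^sup>L lborel (?s m) = 0" for m
  proof -
    have "?s m t = indicator I t *\<^sub>R (f t * \<eta> m t)" for t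
    proof (cases "t \<in> {a<..<b}")
      case False
      then show ?thesis by (simp add: \<eta>_outside[OF False])
    qed (use r in \<open>auto simp: indicator_def\<close>)
    then show ?thesis using zero[OF \<eta>_test[of m]] by (simp only: integral_lebI_eq set_lebesgue_integral_def)
  qed
  ultimately show ?thesis by (simp add: set_lebesgue_integral_def LIMSEQ_const_iff)
qed (simp add: set_lebesgue_integral_def)

text \<open>
  The sets over which the integral vanishes form a Dynkin system that contains the intersection-stable
  generator of open intervals, hence they are all the Borel sets.
\<close>

lemma AE_zero_if_interval_integrals_zero:
  fixes f :: "real \<Rightarrow> real"
  assumes int: "integrable lborel f" and zero: "\<And>a b. (LINT t:{a<..<b}|lborel. f t) = 0"
    and total: "integral\<^sup>L lborel f = 0"
  shows "AE t in lborel. f t = 0"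
proof (rule density_unique_real[of lborel f "\<lambda>_. 0"])
  fix A :: "real set" assume "A \<in> sets lborel"
  define G where "G = range (\<lambda>(a, b). {a<..<b::real})"
  have sets_eq: "sets borel = sigma_sets UNIV G"
    unfolding G_def borel_eq_box box_real by simp
  have set_int: "set_integrable lborel A f" if "A \<in> sets borel" for A
    using that int by (simp add: set_integrable_def integrable_mult_indicator del: real_scaleR_def)
  have "(LINT t:A|lborel. f t) = 0"
  proof (rule sigma_sets_induct_disjoint[of G UNIV A])
    have "{a<..<b} \<inter> {c<..<d} = {max a c<..<min b (d::real)}" for a b c d by auto
    then show "Int_stable G" unfolding G_def Int_stable_def by auto
    show "A \<in> sigma_sets UNIV G" using \<open>A \<in> sets lborel\<close> sets_eq by simp
    show "(LINT t:X|lborel. f t) = 0" if "X \<in> G" for X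
      using that zero by (auto simp: G_def)
    show "(LINT t:{}|lborel. f t) = 0" by (simp add: set_lebesgue_integral_def)
  next
    fix X assume X: "X \<in> sigma_sets UNIV G" "(LINT t:X|lborel. f t) = 0"
    have "(LINT t:X \<union> (UNIV - X)|lborel. f t) = (LINT t:X|lborel. f t) + (LINT t:(UNIV - X)|lborel. f t)"
    proof (rule set_integral_Un)
      have Xb: "X \<in> sets borel" unfolding sets_eq by (rule X(1))
      then show "set_integrable lborel X f" "set_integrable lborel (UNIV - X) f"
        by (simp_all only: set_int borel_comp Compl_eq_Diff_UNIV[symmetric])
    qed auto
    then show "(LINT t:(UNIV - X)|lborel. f t) = 0"
      using X(2) total by (simp add: set_lebesgue_integral_def)
  next
    fix X :: "nat \<Rightarrow> real set"
    assume X: "disjoint_family X" "range X \<subseteq> sigma_sets UNIV G" "\<And>i. (LINT t:X i|lborel. f t) = 0"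
    have "(LINT t:(\<Union>i. X i)|lborel. f t) = (\<Sum>i. (LINT t:X i|lborel. f t))"
    proof (rule lebesgue_integral_countable_add)
      have Xb: "X i \<in> sets borel" for i using X(2) unfolding sets_eq by blast
      then show "X i \<in> sets lborel" for i by simp
      show "set_integrable lborel (\<Union>i. X i) f" by (intro set_int sets.countable_UN) (use Xb in auto)
    qed (use X(1) in \<open>auto simp: disjoint_family_on_def\<close>)
    then show "(LINT t:(\<Union>i. X i)|lborel. f t) = 0" using X(3) by simp
  qed (auto simp: G_def)
  then show "(LINT t:A|lborel. f t) = (LINT t:A|lborel. 0)" by (simp add: set_lebesgue_integral_def)
qed (use int in auto)

lemma fundamental_lemma:
  assumes f: "locally_integrable f" and zero: "\<And>g. test_I g \<Longrightarrow> (\<integral>t. f t * g t \<partial>lebI) = 0"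
  shows "AE t in lebI. f t = 0"
proof -
  define r where "r n = 1 - 1 / real (n + 2)" for n
  have r: "0 < r n" "r n < 1" for n by (auto simp: r_def field_simps)
  have "AE t in lborel. indicator {-r n<..<r n} t *\<^sub>R f t = 0" for n
  proof (rule AE_zero_if_interval_integrals_zero)
    have "set_integrable lborel {-r n<..<r n} f"
      by (rule set_integrable_subset[of _ "{-r n..r n}"])
         (use f r[of n] in \<open>auto simp: locally_integrable_def\<close>)
    then show "integrable lborel (\<lambda>t. indicator {-r n<..<r n} t *\<^sub>R f t)"
      by (simp add: set_integrable_def)
    show "integral\<^sup>L lborel (\<lambda>t. indicator {-r n<..<r n} t *\<^sub>R f t) = 0"
      using fundamental_lemma_interval[OF f zero, of "-r n" "r n"] r[of n]
      by (simp add: set_lebesgue_integral_def)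
    fix a b
    have "indicator {a<..<b} t *\<^sub>R indicator {-r n<..<r n} t *\<^sub>R f t =
      indicator {max a (-r n)<..<min b (r n)} t *\<^sub>R f t" for t
      by (auto simp: indicator_def)
    moreover have "(LINT t:{max a (-r n)<..<min b (r n)}|lborel. f t) = 0"
      using r[of n] by (intro fundamental_lemma_interval[OF f zero]) auto
    ultimately show "(LINT t:{a<..<b}|lborel. indicator {-r n<..<r n} t *\<^sub>R f t) = 0"
      by (simp only: set_lebesgue_integral_def)
  qed
  then have "AE t in lborel. \<forall>n. indicator {-r n<..<r n} t *\<^sub>R f t = 0"
    unfolding AE_all_countable by (rule allI)
  then show ?thesis
    unfolding AE_lebI_iff
  proof eventually_elim
    case (elim t)
    show ?case
    proof
      assume "t \<in> I"
      then have "0 < 1 - \<bar>t\<bar>" by auto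
      then obtain n where n: "1 / real (Suc n) < 1 - \<bar>t\<bar>"
        using nat_approx_posE by blast
      have "1 / real (n + 2) \<le> 1 / real (Suc n)" by (simp add: field_simps)
      with n have "t \<in> {-r n<..<r n}" by (auto simp: r_def)
      with elim[rule_format, of n] show "f t = 0" by simp
    qed
  qed
qed

section \<open>Weak derivatives on the interval\<close>

text \<open>
  The relation \<open>weak_deriv\<close> read on the interval, for the \<open>k\<close>-fold derivative in the only direction.
\<close>

definition weak_I :: "nat \<Rightarrow> (real \<Rightarrow> real) \<Rightarrow> (real \<Rightarrow> real) \<Rightarrow> bool" where
  "weak_I k u v \<longleftrightarrow> (\<forall>g. test_I g \<longrightarrow>
     (\<integral>t. u t * (deriv ^^ k) g t \<partial>lebI) = (-1) ^ k * (\<integral>t. v t * g t \<partial>lebI))"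

lemma weak_I_0: "weak_I 0 u u"
  by (simp add: weak_I_def)

lemma weak_I_trans_1_1: "weak_I 1 u v \<Longrightarrow> weak_I 1 v w \<Longrightarrow> weak_I 2 u w"
  unfolding weak_I_def
proof (intro allI impI)
  fix g assume *: "\<forall>g. test_I g \<longrightarrow> (\<integral>t. u t * (deriv ^^ 1) g t \<partial>lebI) = (-1) ^ 1 * (\<integral>t. v t * g t \<partial>lebI)"
    "\<forall>g. test_I g \<longrightarrow> (\<integral>t. v t * (deriv ^^ 1) g t \<partial>lebI) = (-1) ^ 1 * (\<integral>t. w t * g t \<partial>lebI)"
    "test_I g"
  have "(deriv ^^ 2) g = deriv (deriv g)" "(deriv ^^ 1) h = deriv h" for h :: "real \<Rightarrow> real"
    by (simp_all add: numeral_2_eq_2 One_nat_def)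
  with * test_I_deriv[OF *(3)]
  show "(\<integral>t. u t * (deriv ^^ 2) g t \<partial>lebI) = (-1) ^ 2 * (\<integral>t. w t * g t \<partial>lebI)" by simp
qed

lemma weak_I_diff:
  assumes "weak_I k u v" "weak_I k u' v'"
    and "locally_integrable u" "locally_integrable v" "locally_integrable u'" "locally_integrable v'"
  shows "weak_I k (\<lambda>t. u t - u' t) (\<lambda>t. v t - v' t)"
  unfolding weak_I_def
proof (intro allI impI)
  fix g assume g: "test_I g"
  note gk = test_I_iterated_deriv[OF g, of k]
  show "(\<integral>t. (u t - u' t) * (deriv ^^ k) g t \<partial>lebI) = (-1) ^ k * (\<integral>t. (v t - v' t) * g t \<partial>lebI)"
    using assms(1,2) g
    by (simp add: weak_I_def left_diff_distrib right_diff_distrib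
        locally_integrable_mult_test[OF assms(3) gk] locally_integrable_mult_test[OF assms(5) gk]
        locally_integrable_mult_test[OF assms(4) g] locally_integrable_mult_test[OF assms(6) g])
qed

lemma weak_I_unique:
  assumes "weak_I k u v" "weak_I k u v'" "locally_integrable v" "locally_integrable v'"
  shows "AE t in lebI. v t = v' t"
proof -
  have "AE t in lebI. v t - v' t = 0"
  proof (rule fundamental_lemma)
    show "locally_integrable (\<lambda>t. v t - v' t)" by (intro locally_integrable_diff assms)
    fix g assume g: "test_I g"
    have "(-1) ^ k * (\<integral>t. v t * g t \<partial>lebI) = (-1) ^ k * (\<integral>t. v' t * g t \<partial>lebI)"
      by (rule trans[OF sym[OF assms(1)[unfolded weak_I_def, rule_format, OF g]]
            assms(2)[unfolded weak_I_def, rule_format, OF g]])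
    then show "(\<integral>t. (v t - v' t) * g t \<partial>lebI) = 0"
      by (simp add: left_diff_distrib locally_integrable_mult_test assms g)
  qed
  then show ?thesis by simp
qed

lemma weak_I_cong_AE:
  assumes "weak_I k u v" "AE t in lebI. u t = u' t"
    and [measurable]: "u \<in> borel_measurable lebI" "u' \<in> borel_measurable lebI"
  shows "weak_I k u' v"
  unfolding weak_I_def
proof (intro allI impI)
  fix g assume g: "test_I g"
  have [measurable]: "(deriv ^^ k) g \<in> borel_measurable lebI"
    by (intro continuous_on_I_measurable test_I_continuous_on test_I_iterated_deriv g)
  have "(\<integral>t. u' t * (deriv ^^ k) g t \<partial>lebI) = (\<integral>t. u t * (deriv ^^ k) g t \<partial>lebI)"
    by (rule integral_cong_AE) (use assms(2) in auto)
  with assms(1) g show "(\<integral>t. u' t * (deriv ^^ k) g t \<partial>lebI) = (-1) ^ k * (\<integral>t. v t * g t \<partial>lebI)"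
    by (simp add: weak_I_def)
qed

text \<open>
  Integration by parts. Finitely many kinks are harmless as long as the function is continuous; the
  derivative may jump there, which is the case for the competitor and its derivative.
\<close>

lemma weak_I_classical:
  assumes f: "continuous_on I f" and S: "finite S"
    and f': "\<And>t. t \<in> I - S \<Longrightarrow> (f has_real_derivative f' t) (at t)"
    and int: "locally_integrable f'"
  shows "weak_I 1 f f'"
  unfolding weak_I_def
proof (intro allI impI)
  fix g assume g: "test_I g"
  obtain r where r: "0 < r" "r < 1" "\<And>t. t \<in> I \<Longrightarrow> r < \<bar>t\<bar> \<Longrightarrow> g t = 0"
    using g by (auto simp: test_I_def)
  (* Integrate over a slightly larger interval, so that g vanishes at its ends. *)
  define s where "s = (r + 1) / 2"
  have s: "0 < s" "s < 1" "r < s" using r by (auto simp: s_def)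
  let ?h = "\<lambda>t. f' t * g t + f t * deriv g t"
  have int1: "integrable lebI (\<lambda>t. f' t * g t)" by (rule locally_integrable_mult_test[OF int g])
  have int2: "integrable lebI (\<lambda>t. f t * deriv g t)"
    by (rule locally_integrable_mult_test[OF locally_integrable_continuous[OF f] test_I_deriv[OF g]])
  have "(?h has_integral (f s * g s - f (-s) * g (-s))) {-s..s}"
  proof (rule fundamental_theorem_of_calculus_interior_strong[OF S])
    show "continuous_on {-s..s} (\<lambda>t. f t * g t)"
      using s by (intro continuous_on_mult continuous_on_subset[OF f]
          continuous_on_subset[OF test_I_continuous_on[OF g]]) auto
    fix t assume t: "t \<in> {-s<..<s} - S"
    then have "t \<in> I - S" using s by auto
    then have "((\<lambda>t. f t * g t) has_real_derivative f' t * g t + deriv g t * f t) (at t)"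
      by (intro DERIV_mult f' test_I_DERIV[OF g]) auto
    then show "((\<lambda>t. f t * g t) has_vector_derivative ?h t) (at t)"
      by (simp add: has_real_derivative_iff_has_vector_derivative mult.commute)
  qed (use s in auto)
  then have hi: "(?h has_integral 0) {-s..s}" using r(3)[of s] r(3)[of "-s"] s by simp
  have int_h: "set_integrable lborel {-s..s} ?h"
    using integrable_lebI_iff[THEN iffD1, OF Bochner_Integration.integrable_add[OF int1 int2]] s
    by (elim set_integrable_subset) auto
  have outside: "?h t = 0" if "t \<in> I" "t \<notin> {-s..s}" for t
  proof -
    have "r < \<bar>t\<bar>" using that s by auto
    with deriv_eq_0_if_vanishes[OF r(3) that(1)] r(3)[OF that(1)] show ?thesis
      by (simp add: DERIV_imp_deriv)
  qed
  have "(\<integral>t. ?h t \<partial>lebI) = (LINT t:{-s..s}|lborel. ?h t)"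
    unfolding integral_lebI_eq set_lebesgue_integral_def
  proof (rule Bochner_Integration.integral_cong[OF refl])
    fix t
    show "indicator I t *\<^sub>R ?h t = indicator {-s..s} t *\<^sub>R ?h t"
      using outside[of t] s by (cases "t \<in> I"; cases "t \<in> {-s..s}") (auto simp: indicator_def)
  qed
  also have "\<dots> = 0"
    using set_borel_integral_eq_integral(2)[OF int_h] hi by (simp add: integral_unique)
  finally show "(\<integral>t. f t * (deriv ^^ 1) g t \<partial>lebI) = (-1) ^ 1 * (\<integral>t. f' t * g t \<partial>lebI)"
    using int1 int2 by (simp add: One_nat_def)
qed

lemma weak_I_test: "test_I g \<Longrightarrow> weak_I 1 g (deriv g)"
  by (rule weak_I_classical[of _ "{}"])
     (auto intro: test_I_continuous_on test_I_DERIV locally_integrable_L2I test_I_L2I test_I_deriv)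

section \<open>Sobolev spaces and the functional in dimension one\<close>

lemma weak_deriv_iff: "weak_deriv 1 B (replicate k 0) u v \<longleftrightarrow> weak_I k (u \<circ> pt) (v \<circ> pt)"
proof -
  have eq: "(\<integral>x. u x * partials (replicate k 0) \<eta> x \<partial>vol_on 1 B) =
        (\<integral>t. (u \<circ> pt) t * (deriv ^^ k) (\<eta> \<circ> pt) t \<partial>lebI)"
       "(\<integral>x. v x * \<eta> x \<partial>vol_on 1 B) = (\<integral>t. (v \<circ> pt) t * (\<eta> \<circ> pt) t \<partial>lebI)" for \<eta>
    unfolding integral_ball_eq partials_pt[symmetric] by (simp_all only: o_def)
  show ?thesis
  proof
    assume L: "weak_deriv 1 B (replicate k 0) u v"
    show "weak_I k (u \<circ> pt) (v \<circ> pt)"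
      unfolding weak_I_def
    proof (intro allI impI)
      fix g assume "test_I g"
      moreover have g: "(\<lambda>x. g (x 0)) \<circ> pt = g" by (simp add: o_def)
      ultimately have "test_function 1 B (\<lambda>x. g (x 0))" by (simp only: test_function_iff)
      with L[unfolded weak_deriv_def eq length_replicate, rule_format, of "\<lambda>x. g (x 0)"]
      show "(\<integral>t. (u \<circ> pt) t * (deriv ^^ k) g t \<partial>lebI) = (-1) ^ k * (\<integral>t. (v \<circ> pt) t * g t \<partial>lebI)"
        unfolding g .
    qed
  next
    assume "weak_I k (u \<circ> pt) (v \<circ> pt)"
    then show "weak_deriv 1 B (replicate k 0) u v"
      unfolding weak_deriv_def weak_I_def eq length_replicate test_function_iff by blast
  qed
qed

lemma L2_iff: "u \<in> L2 1 B \<longleftrightarrow> u \<circ> pt \<in> L2I"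
  by (simp only: L2_def L2I_def mem_Collect_eq borel_measurable_ball_iff integrable_ball_iff o_def)

lemma lift_pt: "(\<lambda>x. f (x 0)) \<circ> pt = f"
  by (simp add: o_def)

text \<open>
  In dimension one the multi-index of a derivative is determined by its order.
\<close>

lemma index_list_iff: "set is \<subseteq> {..<1} \<longleftrightarrow> is = replicate (length is) (0::nat)"
proof
  assume "set is \<subseteq> {..<1}"
  then show "is = replicate (length is) 0"
    unfolding lessThan_1 by (intro replicate_length_same[symmetric]) auto
next
  assume "is = replicate (length is) 0"
  then have "\<forall>i\<in>set is. i = 0" by (metis in_set_replicate)
  then show "set is \<subseteq> {..<1}" by auto
qed

lemma H_iff: "u \<in> H 1 k B \<longleftrightarrow> u \<circ> pt \<in> L2I \<and> (\<forall>j\<le>k. \<exists>v\<in>L2I. weak_I j (u \<circ> pt) v)"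
proof -
  have 1: "(\<exists>v\<in>L2 1 B. weak_deriv 1 B (replicate j 0) u v) \<longleftrightarrow> (\<exists>v\<in>L2I. weak_I j (u \<circ> pt) v)" for j
    unfolding weak_deriv_iff L2_iff Bex_def by (metis lift_pt)
  have 2: "(\<forall>is. set is \<subseteq> {..<1} \<and> length is \<le> k \<longrightarrow> P is) \<longleftrightarrow> (\<forall>j\<le>k. P (replicate j 0))" for P :: "nat list \<Rightarrow> bool"
  proof (intro iffI allI impI)
    fix j assume "\<forall>is. set is \<subseteq> {..<1} \<and> length is \<le> k \<longrightarrow> P is" "j \<le> k"
    moreover have "set (replicate j 0) \<subseteq> {..<1::nat}" by auto
    ultimately show "P (replicate j 0)" by (metis length_replicate)
  next
    fix "is" :: "nat list" assume *: "\<forall>j\<le>k. P (replicate j 0)" "set is \<subseteq> {..<1} \<and> length is \<le> k"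
    have eq: "is = replicate (length is) 0" using *(2) index_list_iff by blast
    have "P (replicate (length is) 0)" using * by blast
    then show "P is" by (subst eq)
  qed
  show ?thesis unfolding H_def mem_Collect_eq 2 1 L2_iff ..
qed

text \<open>
  The chosen weak derivative agrees almost everywhere with any other one; this removes the choice
  operator from norms and energies.
\<close>

lemma wderiv_spec:
  assumes "v \<in> L2I" "weak_I k (u \<circ> pt) v"
  shows "wderiv 1 B (replicate k 0) u \<circ> pt \<in> L2I"
    and "AE t in lebI. wderiv 1 B (replicate k 0) u (pt t) = v t"
proof -
  let ?w = "wderiv 1 B (replicate k 0) u"
  have "\<exists>v'. v' \<in> L2 1 B \<and> weak_deriv 1 B (replicate k 0) u v'"
    using assms unfolding L2_iff weak_deriv_iff by (metis lift_pt)
  then have "?w \<in> L2 1 B \<and> weak_deriv 1 B (replicate k 0) u ?w"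
    unfolding wderiv_def by (rule someI_ex)
  then have *: "?w \<circ> pt \<in> L2I" "weak_I k (u \<circ> pt) (?w \<circ> pt)"
    by (simp_all only: L2_iff weak_deriv_iff)
  show "?w \<circ> pt \<in> L2I" by fact
  show "AE t in lebI. ?w (pt t) = v t"
    using weak_I_unique[OF *(2) assms(2) locally_integrable_L2I[OF *(1)] locally_integrable_L2I[OF assms(1)]]
    by simp
qed

lemma integral_wderiv_power2:
  assumes "v \<in> L2I" "weak_I k (u \<circ> pt) v"
  shows "(\<integral>x. (wderiv 1 B (replicate k 0) u x)\<^sup>2 \<partial>vol_on 1 B) = (\<integral>t. (v t)\<^sup>2 \<partial>lebI)"
  unfolding integral_ball_eq o_def
proof (rule integral_cong_AE)
  show "(\<lambda>t. (wderiv 1 B (replicate k 0) u (pt t))\<^sup>2) \<in> borel_measurable lebI"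
    using wderiv_spec(1)[OF assms] by (auto simp: L2I_def o_def)
  show "AE t in lebI. (wderiv 1 B (replicate k 0) u (pt t))\<^sup>2 = (v t)\<^sup>2"
    using wderiv_spec(2)[OF assms] by eventually_elim simp
qed (use assms in \<open>auto simp: L2I_def\<close>)

lemma H1_norm_eq:
  assumes "v \<in> L2I" "weak_I 1 (u \<circ> pt) v"
  shows "H1_norm 1 B u = sqrt ((\<integral>t. (u (pt t))\<^sup>2 \<partial>lebI) + (\<integral>t. (v t)\<^sup>2 \<partial>lebI))"
proof -
  have "(\<integral>x. (wderiv 1 B [0] u x)\<^sup>2 \<partial>vol_on 1 B) = (\<integral>t. (v t)\<^sup>2 \<partial>lebI)"
    using integral_wderiv_power2[OF assms] by (simp add: One_nat_def)
  then show ?thesis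
    unfolding H1_norm_def lessThan_1 by (simp add: integral_ball_eq o_def)
qed

text \<open>
  The integrand of the functional, with the Laplacian given separately as \<open>v\<close>.
\<close>

definition energy :: "(real \<Rightarrow> real) \<Rightarrow> (real \<Rightarrow> real) \<Rightarrow> real \<Rightarrow> real" where
  "energy u v t = (v t)\<^sup>2 + (if u t = 0 then 0 else 1)"

lemma F_eq:
  assumes v: "v \<in> L2I" "weak_I 2 (u \<circ> pt) v" and u: "u \<circ> pt \<in> L2I"
    and u': "u' \<in> borel_measurable lebI" "AE t in lebI. u (pt t) = u' t"
  shows "F 1 B u = (\<integral>t. energy u' v t \<partial>lebI)"
proof -
  have two: "[0,0] = replicate 2 (0::nat)" by (simp add: numeral_2_eq_2)
  have [measurable]: "v \<in> borel_measurable lebI" "u' \<in> borel_measurable lebI"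
    "(\<lambda>t. u (pt t)) \<in> borel_measurable lebI"
    "(\<lambda>t. wderiv 1 B (replicate 2 0) u (pt t)) \<in> borel_measurable lebI"
    using u u' v wderiv_spec(1)[OF v] by (auto simp: L2I_def o_def)
  have "F 1 B u = (\<integral>t. (wderiv 1 B (replicate 2 0) u (pt t))\<^sup>2 + indicator {x \<in> B. u x \<noteq> 0} (pt t) \<partial>lebI)"
    unfolding F_def laplacian_def lessThan_1 integral_ball_eq by (simp add: o_def two)
  also have "\<dots> = (\<integral>t. (wderiv 1 B (replicate 2 0) u (pt t))\<^sup>2 + (if u (pt t) = 0 then 0 else 1) \<partial>lebI)"
    by (rule Bochner_Integration.integral_cong) (auto simp: unit_ball_1 indicator_def)
  also have "\<dots> = (\<integral>t. energy u' v t \<partial>lebI)"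
    unfolding energy_def
  proof (rule integral_cong_AE)
    show "AE t in lebI. (wderiv 1 B (replicate 2 0) u (pt t))\<^sup>2 + (if u (pt t) = 0 then 0 else 1) =
        (v t)\<^sup>2 + (if u' t = 0 then 0 else 1)"
      using wderiv_spec(2)[OF v] u'(2) by eventually_elim simp
  qed measurable
  finally show ?thesis .
qed

section \<open>The boundary datum and the competitor\<close>

lemma flat1_has_derivative: "(flat1 has_real_derivative flat [:0, 0, 1:] x) (at x)"
  using flat_has_derivative[of 1 x] by (simp add: flat_step_def)

text \<open>
  For \<open>s > 0\<close> and \<open>y = 1/s\<close> the left-hand side is \<open>(y + y\<^sup>2) exp(-y)\<close>. This weighted bound is what controls the
  derivative of a cutoff at distance \<open>(s + 1)/m\<close> from the boundary.
\<close>

lemma flat_square_bound: "\<bar>flat [:0, 0, 1:] s\<bar> * (s + 1) \<le> 3"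
proof (cases "s > 0")
  case True
  define y where "y = 1 / s"
  have y: "y > 0" using True by (simp add: y_def)
  have "1 + y + y\<^sup>2 / 2 \<le> exp y" using exp_lower_Taylor_quadratic[of y] y by simp
  then have "y + y\<^sup>2 \<le> 3 * exp y" using y by (smt (verit) zero_le_power2 field_sum_of_halves)
  then have "(y + y\<^sup>2) * exp (- y) \<le> 3" by (simp add: exp_minus field_simps)
  moreover have "\<bar>flat [:0, 0, 1:] s\<bar> * (s + 1) = (y + y\<^sup>2) * exp (- y)"
    using True by (simp add: flat_def y_def abs_mult power2_eq_square field_simps)
  ultimately show ?thesis by simp
qed (simp add: flat_def)

lemma flat_square_decay: "((\<lambda>s. flat [:0, 0, 1:] s * (s + 1)) \<longlongrightarrow> 0) at_top"
proof -
  have "((\<lambda>s::real. (inverse s + (inverse s)\<^sup>2) * exp (- inverse s)) \<longlongrightarrow> (0 + 0\<^sup>2) * exp (- 0)) at_top"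
    by (intro tendsto_intros tendsto_inverse_0_at_top filterlim_ident)
  moreover have "eventually (\<lambda>s. (inverse s + (inverse s)\<^sup>2) * exp (- inverse s) = flat [:0, 0, 1:] s * (s + 1)) at_top"
    using eventually_gt_at_top[of 0]
    by eventually_elim (simp add: flat_def power2_eq_square field_simps)
  ultimately show ?thesis by (auto intro: Lim_transform_eventually)
qed

text \<open>
  The deflection of a beam of length \<open>1\<close> that is clamped at \<open>0\<close>, moment-free at \<open>1\<close>, and lifted by
  \<open>1/3\<close> at its end: \<open>cubic'' x = 1 - x\<close>.
\<close>

definition cubic :: "real \<Rightarrow> real" where "cubic x = x\<^sup>2 / 2 - x ^ 3 / 6"

text \<open>
  Any smooth function with boundary values \<open>0\<close> and \<open>1/3\<close> would define the same admissible class. This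
  one also vanishes on \<open>[-1, 0]\<close>, like the competitor, so that the difference of the two needs to be
  cut off only near \<open>0\<close> and \<open>1\<close>. The factor \<open>exp 1\<close> compensates \<open>flat1 1 = exp (-1)\<close>.
\<close>

definition datum :: "real \<Rightarrow> real" where "datum x = exp 1 * (flat1 x * cubic x)"

text \<open>
  The beam lies on the ground up to \<open>0\<close> and is lifted from there. The length \<open>1\<close> of the lifted part
  minimises \<open>L + 1/(3L^3)\<close>.
\<close>

definition competitor :: "real \<Rightarrow> real" where "competitor x = cubic (max 0 x)"
definition competitor' :: "real \<Rightarrow> real" where "competitor' x = max 0 x - (max 0 x)\<^sup>2 / 2"
definition competitor'' :: "real \<Rightarrow> real" where "competitor'' x = (if x > 0 then 1 - x else 0)"

lemma cubic_smooth: "cubic \<in> smooth_alg"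
proof -
  have "(\<lambda>x. (1/2) * (x * x) + (-1/6) * (x * (x * x))) \<in> smooth_alg"
    by (intro smooth_alg.intros)
  then show ?thesis by (simp add: cubic_def[abs_def] power2_eq_square power3_eq_cube mult.assoc)
qed

lemma flat1_smooth: "flat1 \<in> smooth_alg"
  using smooth_alg.flat[of 1 1 0] by simp

lemma datum_smooth: "datum \<in> smooth_alg"
  unfolding datum_def by (intro smooth_alg.intros flat1_smooth cubic_smooth)

lemma lift_smooth_C_infinity_closure:
  assumes "f \<in> smooth_alg"
  shows "C_infinity_closure 1 B (\<lambda>x. f (x 0))"
proof -
  have lift: "continuous_on A (\<lambda>x::point. (deriv ^^ k) f (x 0))" for A k
    by (rule continuous_on_compose2[OF smooth_alg_continuous_on continuous_on_coord])
       (auto intro: smooth_alg_iterated_deriv assms)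
  have "C_infinity 1 B (\<lambda>x. f (x 0))"
    unfolding C_infinity_def C_k_ball_iff lift_pt
    by (auto intro: smooth_alg_continuous_on smooth_alg_differentiable smooth_alg_iterated_deriv assms)
  moreover have "continuous_on (closure B) (\<lambda>x. f (x 0))" using lift[of _ 0] by simp
  moreover have "\<exists>g. continuous_on (closure B) g \<and> (\<forall>x\<in>B. g x = partials is (\<lambda>x. f (x 0)) x)"
    if "set is \<subseteq> {..<1}" for "is"
    using lift[of "closure B" "length is"] index_list_iff[THEN iffD1, OF that]
    by (metis partials_lift)
  ultimately show ?thesis unfolding C_infinity_closure_def by blast
qed

lemma continuous_on_competitor: "continuous_on A competitor" "continuous_on A competitor'"
  unfolding competitor_def competitor'_def cubic_def by (auto intro!: continuous_intros)

text \<open>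
  Away from the kink of \<open>max 0\<close>, the composite is locally either \<open>f\<close> or constant.
\<close>

lemma DERIV_max_comp:
  fixes f :: "real \<Rightarrow> real"
  assumes "t \<noteq> 0" "(f has_real_derivative f') (at t)"
  shows "((\<lambda>x. f (max 0 x)) has_real_derivative (if t > 0 then f' else 0)) (at t)"
proof (cases "t > 0")
  case True
  have "eventually (\<lambda>x. f (max 0 x) = f x) (nhds t)"
    using True by (auto simp: eventually_nhds intro!: exI[of _ "{0<..}"])
  then show ?thesis using True assms by (subst DERIV_cong_ev[OF refl _ refl]) auto
next
  case False
  have "eventually (\<lambda>x. f (max 0 x) = f 0) (nhds t)"
    using False assms(1) by (auto simp: eventually_nhds intro!: exI[of _ "{..<0}"])
  then show ?thesis using False by (subst DERIV_cong_ev[OF refl _ refl]) auto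
qed

lemma competitor''_L2I: "competitor'' \<in> L2I"
proof (rule L2I_bounded[of _ 1])
  show "competitor'' \<in> borel_measurable lebI"
    unfolding competitor''_def[abs_def] by (intro measurable_restrict_space1) measurable
qed (auto simp: competitor''_def)

lemma weak_I_competitor: "weak_I 1 competitor competitor'" "weak_I 1 competitor' competitor''"
proof -
  show "weak_I 1 competitor competitor'"
  proof (rule weak_I_classical[of _ "{0}"])
    fix t :: real assume t: "t \<in> I - {0}"
    have "(cubic has_real_derivative t - t\<^sup>2 / 2) (at t)"
      unfolding cubic_def by (auto intro!: derivative_eq_intros simp: power2_eq_square)
    from DERIV_max_comp[OF _ this] t
    show "(competitor has_real_derivative competitor' t) (at t)"
      unfolding competitor_def[abs_def] competitor'_def by (auto split: if_splits simp: max_def)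
  qed (auto intro!: continuous_on_competitor locally_integrable_continuous)
  show "weak_I 1 competitor' competitor''"
  proof (rule weak_I_classical[of _ "{0}"])
    fix t :: real assume t: "t \<in> I - {0}"
    have "((\<lambda>x. x - x\<^sup>2 / 2) has_real_derivative 1 - t) (at t)"
      by (auto intro!: derivative_eq_intros)
    from DERIV_max_comp[OF _ this] t
    show "(competitor' has_real_derivative competitor'' t) (at t)"
      unfolding competitor'_def[abs_def] competitor''_def by auto
  qed (auto intro!: continuous_on_competitor locally_integrable_L2I competitor''_L2I)
qed

lemma competitor_L2I: "competitor \<in> L2I" "competitor' \<in> L2I"
  by (intro L2I_continuous continuous_on_competitor)+

lemma competitor_in_H2: "(\<lambda>x. competitor (x 0)) \<in> H 1 2 B"
  unfolding H_iff lift_pt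
proof (intro conjI allI impI competitor_L2I)
  fix j :: nat assume "j \<le> 2"
  then consider "j = 0" | "j = 1" | "j = 2" by linarith
  then show "\<exists>v\<in>L2I. weak_I j competitor v"
    by cases (use weak_I_0 competitor_L2I weak_I_competitor weak_I_trans_1_1[OF weak_I_competitor] competitor''_L2I in blast)+
qed

lemma energy_integrable:
  assumes [measurable]: "u \<in> borel_measurable lebI" and v: "v \<in> L2I"
  shows "integrable lebI (energy u v)"
  unfolding energy_def
proof (rule Bochner_Integration.integrable_add)
  show "integrable lebI (\<lambda>t. (v t)\<^sup>2)" using v by (simp add: L2I_def)
  show "integrable lebI (\<lambda>t. if u t = 0 then 0 else 1 :: real)"
    by (intro L2I_integrable L2I_bounded[of _ 1]) auto
qed

lemma F_competitor: "F 1 B (\<lambda>x. competitor (x 0)) \<le> 4 / 3"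
proof -
  have "F 1 B (\<lambda>x. competitor (x 0)) = (\<integral>t. energy competitor competitor'' t \<partial>lebI)"
    using competitor_L2I competitor''_L2I weak_I_trans_1_1[OF weak_I_competitor]
    by (intro F_eq) (auto simp: lift_pt L2I_def)
  also have "\<dots> = (\<integral>t. indicator I t *\<^sub>R energy competitor competitor'' t \<partial>lborel)"
    by (simp add: integral_lebI_eq set_lebesgue_integral_def)
  also have "\<dots> \<le> (\<integral>t. indicator {0..1} t *\<^sub>R ((1 - t)\<^sup>2 + 1) \<partial>lborel)"
  proof (rule integral_mono)
    have "integrable lebI (energy competitor competitor'')"
      using competitor_L2I competitor''_L2I by (intro energy_integrable) (auto simp: L2I_def)
    then show "integrable lborel (\<lambda>t. indicator I t *\<^sub>R energy competitor competitor'' t)"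
      by (simp add: integrable_lebI_iff set_integrable_def)
    show "integrable lborel (\<lambda>t::real. indicator {0..1} t *\<^sub>R ((1 - t)\<^sup>2 + 1))"
      by (intro borel_integrable_compact) (auto intro!: continuous_intros)
    fix t
    show "indicator I t *\<^sub>R energy competitor competitor'' t \<le> indicator {0..1} t *\<^sub>R ((1 - t)\<^sup>2 + 1)"
      by (auto simp: indicator_def energy_def competitor''_def competitor_def cubic_def)
  qed
  also have "\<dots> = 4 / 3"
  proof -
    have "(\<integral>t. indicator {0..1} t *\<^sub>R ((1 - t)\<^sup>2 + 1) \<partial>lborel) =
        (\<lambda>t. t - (1 - t) ^ 3 / 3) 1 - (\<lambda>t. t - (1 - t) ^ 3 / 3) (0::real)"
    proof (rule integral_FTC_atLeastAtMost)
      fix t :: real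
      have "((\<lambda>t. t - (1 - t) ^ 3 / 3) has_real_derivative (1 - t)\<^sup>2 + 1) (at t within {0..1})"
        by (auto intro!: derivative_eq_intros)
      then show "((\<lambda>t. t - (1 - t) ^ 3 / 3) has_vector_derivative (1 - t)\<^sup>2 + 1) (at t within {0..1})"
        by (simp add: has_real_derivative_iff_has_vector_derivative)
    qed (auto intro!: continuous_intros)
    then show ?thesis by simp
  qed
  finally show ?thesis .
qed

section \<open>The competitor is admissible\<close>

text \<open>
  On \<open>(0, 1)\<close> this is the competitor minus the datum. It vanishes to second order at \<open>0\<close> and to first
  order at \<open>1\<close>.
\<close>

definition gap :: "real \<Rightarrow> real" where
  "gap x = cubic x * (1 - exp 1 * flat1 x)"

text \<open>
  The shift by \<open>1\<close> in the second factor keeps the support away from the endpoint \<open>1\<close>. The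
  support may reach \<open>0\<close>, which is an interior point of \<open>(-1, 1)\<close>.
\<close>

definition cutoff :: "real \<Rightarrow> real \<Rightarrow> real" where
  "cutoff m x = flat1 (m * x) * flat1 (m * (1 - x) - 1)"

definition cutoff' :: "real \<Rightarrow> real \<Rightarrow> real" where
  "cutoff' m x = m * flat [:0, 0, 1:] (m * x) * flat1 (m * (1 - x) - 1) -
                flat1 (m * x) * (m * flat [:0, 0, 1:] (m * (1 - x) - 1))"

lemma gap_smooth: "gap \<in> smooth_alg"
proof -
  have "(\<lambda>x. cubic x * (1 + (- exp 1) * flat1 x)) \<in> smooth_alg"
    by (intro smooth_alg.intros flat1_smooth cubic_smooth)
  then show ?thesis by (simp add: gap_def[abs_def])
qed

lemma cutoff_smooth: "cutoff m \<in> smooth_alg"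
proof -
  have "(\<lambda>x. flat1 (m * x + 0) * flat1 ((- m) * x + (m - 1))) \<in> smooth_alg"
    by (intro smooth_alg.intros)
  moreover have "(- m) * x + (m - 1) = m * (1 - x) - 1" for x by (simp add: algebra_simps)
  ultimately show ?thesis unfolding cutoff_def[abs_def] by (simp only: add_0_right)
qed

lemma cutoff_has_derivative: "(cutoff m has_real_derivative cutoff' m x) (at x)"
proof -
  have "((\<lambda>x. m * x) has_real_derivative m) (at x)"
    "((\<lambda>x. m * (1 - x) - 1) has_real_derivative - m) (at x)"
    by (auto intro!: derivative_eq_intros)
  from DERIV_mult[OF DERIV_chain2[OF flat1_has_derivative this(1)] DERIV_chain2[OF flat1_has_derivative this(2)]]
  show ?thesis unfolding cutoff_def[abs_def] cutoff'_def by (simp add: algebra_simps)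
qed

lemma cutoff_bounds: "0 \<le> cutoff m x" "cutoff m x \<le> 1"
  unfolding cutoff_def by (auto intro!: mult_nonneg_nonneg mult_le_one flat1_nonneg flat1_le_1)

lemma cutoff_eq_0:
  assumes "m > 0" "x \<le> 0 \<or> 1 - 1 / m \<le> x"
  shows "cutoff m x = 0" "cutoff' m x = 0"
proof -
  have "m * x \<le> 0 \<or> m * (1 - x) - 1 \<le> 0"
    using assms by (auto simp: mult_le_0_iff field_simps)
  then show "cutoff m x = 0" "cutoff' m x = 0"
    by (auto simp: cutoff_def cutoff'_def flat_def)
qed

lemma cubic_bounds: assumes "0 < x" "x < 1" shows "0 < cubic x" "cubic x \<le> x\<^sup>2 / 2"
proof -
  have "cubic x = x\<^sup>2 * ((3 - x) / 6)" by (simp add: cubic_def power2_eq_square power3_eq_cube field_simps)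
  also have "\<dots> > 0" using assms by (intro mult_pos_pos) auto
  finally show "0 < cubic x" .
  show "cubic x \<le> x\<^sup>2 / 2" using assms by (simp add: cubic_def)
qed

lemma gap_bounds:
  assumes "0 < x" "x < 1"
  shows "0 \<le> gap x" "gap x \<le> x\<^sup>2" "gap x \<le> 1 - x"
proof -
  have eq: "gap x = cubic x * (1 - exp (1 - 1 / x))"
    using assms by (simp add: gap_def flat_def mult_exp_exp)
  have "1 / x \<ge> 1" using assms by simp
  then have e: "0 \<le> 1 - exp (1 - 1 / x)" "1 - exp (1 - 1 / x) \<le> 1" by simp_all
  have "1 - exp (1 - 1 / x) \<le> 1 / x - 1" using exp_ge_add_one_self[of "1 - 1 / x"] by linarith
  then have e2: "1 - exp (1 - 1 / x) \<le> (1 - x) / x" using assms by (simp add: field_simps)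
  note c = cubic_bounds[OF assms]
  show "0 \<le> gap x" unfolding eq using c e by simp
  have "gap x \<le> cubic x * 1" unfolding eq using c e by (intro mult_left_mono) auto
  also have "\<dots> \<le> x\<^sup>2" using c by simp
  finally show "gap x \<le> x\<^sup>2" .
  have "gap x \<le> (x\<^sup>2 / 2) * ((1 - x) / x)"
    unfolding eq using c e e2 by (intro mult_mono) auto
  also have "\<dots> = x / 2 * (1 - x)" using assms by (simp add: power2_eq_square)
  also have "\<dots> \<le> 1 * (1 - x)" using assms by (intro mult_right_mono) auto
  finally show "gap x \<le> 1 - x" by simp
qed

text \<open>
  The derivative of the cutoff is of size \<open>m\<close> in layers of width \<open>1/m\<close>, and the decay of \<open>gap\<close>
  compensates this: quadratic decay at \<open>0\<close> gives the first term, linear decay at \<open>1\<close> the second. At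
  \<open>1\<close> the decay only balances the growth, so the second term is bounded but not small uniformly in
  \<open>x\<close>; it tends to \<open>0\<close> pointwise.
\<close>

lemma gap_cutoff'_bound:
  assumes "0 < x" "x < 1" "m \<ge> 1"
  shows "\<bar>gap x * cutoff' m x\<bar> \<le> 1 / m + \<bar>flat [:0, 0, 1:] (m * (1 - x) - 1) * (m * (1 - x) - 1 + 1)\<bar>"
    (is "_ \<le> 1 / m + \<bar>?k\<bar>")
proof -
  let ?f = "flat [:0, 0, 1:]"
  have "gap x * (m * ?f (m * x) * flat1 (m * (1 - x) - 1)) \<le> x\<^sup>2 * (1 / (m * x\<^sup>2) * 1)"
  proof (intro mult_mono)
    have "?f (m * x) \<le> (1 / (m * x))\<^sup>2 * 1"
    proof -
      have "?f (m * x) = (1 / (m * x))\<^sup>2 * exp (- (1 / (m * x)))"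
        using assms by (simp add: flat_def power2_eq_square)
      also have "\<dots> \<le> (1 / (m * x))\<^sup>2 * 1" using assms by (intro mult_left_mono) auto
      finally show ?thesis .
    qed
    then have "m * ?f (m * x) \<le> m * ((1 / (m * x))\<^sup>2 * 1)"
      using assms by (intro mult_left_mono) auto
    also have "\<dots> = 1 / (m * x\<^sup>2)" using assms by (simp add: power2_eq_square)
    finally show "m * ?f (m * x) \<le> 1 / (m * x\<^sup>2)" .
  qed (use assms gap_bounds[OF assms(1,2)] flat1_le_1 flat1_nonneg in \<open>auto simp: flat_def\<close>)
  also have "\<dots> = 1 / m" using assms by simp
  finally have G1: "gap x * (m * ?f (m * x) * flat1 (m * (1 - x) - 1)) \<le> 1 / m" .
  have f0: "0 \<le> ?f s" for s by (simp add: flat_def)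
  have G1': "0 \<le> gap x * (m * ?f (m * x) * flat1 (m * (1 - x) - 1))"
    using assms gap_bounds[OF assms(1,2)] f0 flat1_nonneg by (intro mult_nonneg_nonneg) auto
  have G2: "gap x * (flat1 (m * x) * (m * ?f (m * (1 - x) - 1))) \<le> (1 - x) * (1 * (m * ?f (m * (1 - x) - 1)))"
    using assms gap_bounds[OF assms(1,2)] f0 flat1_nonneg flat1_le_1 by (intro mult_mono) auto
  have G2': "0 \<le> gap x * (flat1 (m * x) * (m * ?f (m * (1 - x) - 1)))"
    using assms gap_bounds[OF assms(1,2)] f0 flat1_nonneg by (intro mult_nonneg_nonneg) auto
  have "(1 - x) * (1 * (m * ?f (m * (1 - x) - 1))) = ?k" by (simp add: algebra_simps)
  with G2 have G3: "gap x * (flat1 (m * x) * (m * ?f (m * (1 - x) - 1))) \<le> \<bar>?k\<bar>" by linarith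
  show ?thesis
    unfolding cutoff'_def right_diff_distrib using G1 G1' G2' G3 unfolding right_diff_distrib by linarith
qed

lemma gap_cutoff'_bounded:
  assumes "0 < x" "x < 1" "m \<ge> 1" shows "\<bar>gap x * cutoff' m x\<bar> \<le> 4"
proof -
  let ?s = "m * (1 - x) - 1"
  have "\<bar>flat [:0, 0, 1:] ?s * (?s + 1)\<bar> \<le> 3"
    using flat_square_bound[of ?s] assms by (simp add: abs_mult)
  moreover have "1 / m \<le> 1" using assms by simp
  ultimately show ?thesis using gap_cutoff'_bound[OF assms] by linarith
qed

lemma cutoff_tendsto_1:
  assumes "0 < x" "x < 1" shows "(\<lambda>m. cutoff (real m) x) \<longlonglongrightarrow> 1"
proof -
  have "(\<lambda>m. flat1 (real m * x + 0) * flat1 (real m * (1 - x) + (- 1))) \<longlonglongrightarrow> 1 * 1"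
    using assms by (intro tendsto_mult flat1_affine_tendsto_1) auto
  then show ?thesis by (simp add: cutoff_def)
qed

lemma gap_cutoff'_tendsto_0:
  assumes "0 < x" "x < 1" shows "(\<lambda>m. gap x * cutoff' (real m) x) \<longlonglongrightarrow> 0"
proof (rule Lim_null_comparison)
  let ?s = "\<lambda>m. real m * (1 - x) - 1"
  show "\<forall>\<^sub>F m in sequentially. norm (gap x * cutoff' (real m) x)
      \<le> 1 / real m + \<bar>flat [:0, 0, 1:] (?s m) * (?s m + 1)\<bar>"
    using eventually_ge_at_top[of 1]
  proof eventually_elim
    case (elim m)
    then show ?case using gap_cutoff'_bound[OF assms, of "real m"] by simp
  qed
  have "(\<lambda>m. flat [:0, 0, 1:] (real m * (1 - x) + (-1)) * (real m * (1 - x) + (-1) + 1)) \<longlonglongrightarrow> 0"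
    using assms by (intro filterlim_compose[OF flat_square_decay filterlim_nat_affine]) auto
  then have "(\<lambda>m. \<bar>flat [:0, 0, 1:] (?s m) * (?s m + 1)\<bar>) \<longlonglongrightarrow> 0"
    by (intro tendsto_rabs_zero) simp
  from tendsto_add[OF lim_1_over_n this]
  show "(\<lambda>m. 1 / real m + \<bar>flat [:0, 0, 1:] (?s m) * (?s m + 1)\<bar>) \<longlonglongrightarrow> 0" by simp
qed

text \<open>
  The competitor minus the datum on the whole interval.
\<close>

definition gap_plus :: "real \<Rightarrow> real" where "gap_plus x = (if x > 0 then gap x else 0)"
definition gap_plus' :: "real \<Rightarrow> real" where "gap_plus' x = (if x > 0 then deriv gap x else 0)"

lemma gap_plus_eq: "competitor x - datum x = gap_plus x"
  by (cases "x > 0")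
     (simp_all add: competitor_def datum_def gap_plus_def gap_def flat_def max_def algebra_simps cubic_def[of 0])

lemma gap_plus_continuous: "continuous_on A gap_plus"
proof -
  have "continuous_on A (\<lambda>x. competitor x - datum x)"
    by (intro continuous_on_diff continuous_on_competitor smooth_alg_continuous_on datum_smooth)
  then show ?thesis by (simp add: gap_plus_eq[abs_def])
qed

lemma gap_has_derivative: "(gap has_real_derivative deriv gap x) (at x)"
  using smooth_alg_differentiable[OF gap_smooth] by (simp add: DERIV_deriv_iff_real_differentiable)

lemma deriv_gap_bounded: obtains K where "\<And>x. x \<in> {0..1} \<Longrightarrow> \<bar>deriv gap x\<bar> \<le> K"
proof -
  have "bounded (deriv gap ` {0..1})"
    by (intro compact_imp_bounded compact_continuous_image smooth_alg_continuous_on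
        smooth_alg_deriv gap_smooth) auto
  then obtain K where "\<forall>x\<in>{0..1}. \<bar>deriv gap x\<bar> \<le> K" by (auto simp: bounded_iff)
  then show thesis using that by blast
qed

lemma gap_plus'_L2I: "gap_plus' \<in> L2I"
proof -
  obtain K where K: "\<And>x. x \<in> {0..1} \<Longrightarrow> \<bar>deriv gap x\<bar> \<le> K" using deriv_gap_bounded by blast
  have "\<bar>gap_plus' x\<bar> \<le> \<bar>K\<bar>" if "x \<in> I" for x
    using K[of x] that by (auto simp: gap_plus'_def)
  moreover have [measurable]: "deriv gap \<in> borel_measurable borel"
    by (intro borel_measurable_continuous_onI smooth_alg_continuous_on smooth_alg_deriv gap_smooth)
  have "gap_plus' \<in> borel_measurable lebI"
    unfolding gap_plus'_def[abs_def] by (intro measurable_restrict_space1) measurable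
  ultimately show ?thesis by (intro L2I_bounded[of _ "\<bar>K\<bar>"]) auto
qed

lemma weak_I_gap_plus: "weak_I 1 gap_plus gap_plus'"
proof (rule weak_I_classical[of _ "{0}"])
  fix t :: real assume t: "t \<in> I - {0}"
  show "(gap_plus has_real_derivative gap_plus' t) (at t)"
  proof (cases "t > 0")
    case True
    have "eventually (\<lambda>x. gap_plus x = gap x) (nhds t)"
      using True by (auto simp: eventually_nhds gap_plus_def intro!: exI[of _ "{0<..}"])
    then show ?thesis using True gap_has_derivative
      by (subst DERIV_cong_ev[OF refl _ refl]) (auto simp: gap_plus'_def)
  next
    case False
    have "eventually (\<lambda>x. gap_plus x = 0) (nhds t)"
      using False t by (auto simp: eventually_nhds gap_plus_def intro!: exI[of _ "{..<0}"])
    then show ?thesis using False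
      by (subst DERIV_cong_ev[OF refl _ refl]) (auto simp: gap_plus'_def)
  qed
qed (auto intro!: gap_plus_continuous locally_integrable_L2I gap_plus'_L2I)

text \<open>
  The index is shifted by \<open>2\<close> so that the radius \<open>1 - 1/(m + 2)\<close> of the support is positive.
\<close>

definition approx :: "nat \<Rightarrow> real \<Rightarrow> real" where
  "approx m x = gap x * cutoff (real (m + 2)) x"

lemma approx_smooth: "approx m \<in> smooth_alg"
  unfolding approx_def by (intro smooth_alg.intros gap_smooth cutoff_smooth)

lemma approx_test: "test_I (approx m)"
proof (rule smooth_alg_test_I[OF approx_smooth])
  let ?r = "1 - 1 / real (m + 2)"
  show "0 < ?r" "?r < 1" by (auto simp: field_simps)
  fix t assume "t \<in> I" "?r < \<bar>t\<bar>"
  then have "t \<le> 0 \<or> ?r \<le> t" by linarith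
  then have "cutoff (real (m + 2)) t = 0" by (intro cutoff_eq_0) auto
  then show "approx m t = 0" by (simp add: approx_def)
qed

lemma deriv_approx:
  "deriv (approx m) x = deriv gap x * cutoff (real (m + 2)) x + gap x * cutoff' (real (m + 2)) x"
  using DERIV_mult[OF gap_has_derivative[of x] cutoff_has_derivative[of "real (m + 2)" x]]
  unfolding approx_def[abs_def] by (intro DERIV_imp_deriv) (simp add: mult.commute add.commute)

lemma L2_dominated_convergence:
  fixes C :: real
  assumes f: "f \<in> borel_measurable lebI" and s: "\<And>m. s m \<in> borel_measurable lebI"
    and bound: "\<And>m t. t \<in> I \<Longrightarrow> \<bar>f t - s m t\<bar> \<le> C"
    and lim: "\<And>t. t \<in> I \<Longrightarrow> (\<lambda>m. s m t) \<longlonglongrightarrow> f t"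
  shows "(\<lambda>m. \<integral>t. (f t - s m t)\<^sup>2 \<partial>lebI) \<longlonglongrightarrow> 0"
proof -
  have "(\<lambda>m. \<integral>t. (f t - s m t)\<^sup>2 \<partial>lebI) \<longlonglongrightarrow> (\<integral>t. 0 \<partial>lebI)"
  proof (rule integral_dominated_convergence[where w = "\<lambda>_. C\<^sup>2"])
    show "integrable lebI (\<lambda>_. C\<^sup>2)" by (rule finite_measure.integrable_const[OF finite_measure_lebI])
    show "AE t in lebI. norm ((f t - s m t)\<^sup>2) \<le> C\<^sup>2" for m
      using bound by (auto intro!: AE_I2 abs_le_square_iff[THEN iffD1] order_trans[OF _ abs_ge_self])
    show "AE t in lebI. (\<lambda>m. (f t - s m t)\<^sup>2) \<longlonglongrightarrow> 0"
    proof (rule AE_I2)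
      fix t assume "t \<in> space lebI"
      then have "(\<lambda>m. (f t - s m t)\<^sup>2) \<longlonglongrightarrow> (f t - f t)\<^sup>2" by (intro tendsto_intros lim) simp
      then show "(\<lambda>m. (f t - s m t)\<^sup>2) \<longlonglongrightarrow> 0" by simp
    qed
  qed (use f s in auto)
  then show ?thesis by simp
qed

lemma approx_L2_limit: "(\<lambda>m. \<integral>t. (gap_plus t - approx m t)\<^sup>2 \<partial>lebI) \<longlonglongrightarrow> 0"
proof (rule L2_dominated_convergence[where C = 1])
  show "gap_plus \<in> borel_measurable lebI" by (intro continuous_on_I_measurable gap_plus_continuous)
  show "approx m \<in> borel_measurable lebI" for m
    by (intro continuous_on_I_measurable smooth_alg_continuous_on approx_smooth)
  show "\<bar>gap_plus t - approx m t\<bar> \<le> 1" if "t \<in> I" for m t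
  proof (cases "t > 0")
    case True
    with that gap_bounds[of t] have g: "0 \<le> gap t" "gap t \<le> 1" by auto
    have "gap_plus t - approx m t = gap t * (1 - cutoff (real (m + 2)) t)"
      using True by (simp add: gap_plus_def approx_def algebra_simps)
    moreover have "\<bar>gap t * (1 - cutoff (real (m + 2)) t)\<bar> \<le> 1"
      using g cutoff_bounds[of "real (m + 2)" t] by (simp add: abs_mult mult_le_one)
    ultimately show ?thesis by simp
  next
    case False
    then show ?thesis by (simp add: gap_plus_def approx_def cutoff_eq_0)
  qed
  show "(\<lambda>m. approx m t) \<longlonglongrightarrow> gap_plus t" if "t \<in> I" for t
  proof (cases "t > 0")
    case True
    have "(\<lambda>m. gap t * cutoff (real (m + 2)) t) \<longlonglongrightarrow> gap t * 1"
      using True that by (intro tendsto_intros LIMSEQ_ignore_initial_segment cutoff_tendsto_1) auto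
    then show ?thesis using True by (simp add: gap_plus_def approx_def)
  next
    case False
    then show ?thesis by (simp add: gap_plus_def approx_def cutoff_eq_0)
  qed
qed

lemma approx'_L2_limit: "(\<lambda>m. \<integral>t. (gap_plus' t - deriv (approx m) t)\<^sup>2 \<partial>lebI) \<longlonglongrightarrow> 0"
proof -
  obtain K where K: "\<And>x. x \<in> {0..1} \<Longrightarrow> \<bar>deriv gap x\<bar> \<le> K" using deriv_gap_bounded by blast
  have K0: "0 \<le> K" using K[of 0] by simp
  show ?thesis
  proof (rule L2_dominated_convergence[where C = "K + 4"])
    show "gap_plus' \<in> borel_measurable lebI" using gap_plus'_L2I by (simp add: L2I_def)
    show "deriv (approx m) \<in> borel_measurable lebI" for m
      by (intro continuous_on_I_measurable smooth_alg_continuous_on smooth_alg_deriv approx_smooth)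
    show "\<bar>gap_plus' t - deriv (approx m) t\<bar> \<le> K + 4" if "t \<in> I" for m t
    proof (cases "t > 0")
      case True
      let ?c = "cutoff (real (m + 2)) t" and ?d = "gap t * cutoff' (real (m + 2)) t"
      have "gap_plus' t - deriv (approx m) t = deriv gap t * (1 - ?c) - ?d"
        using True by (simp add: gap_plus'_def deriv_approx algebra_simps)
      moreover have "\<bar>deriv gap t * (1 - ?c)\<bar> \<le> K * 1"
        unfolding abs_mult using K[of t] True that cutoff_bounds[of "real (m + 2)" t] K0
        by (intro mult_mono) auto
      moreover have "\<bar>?d\<bar> \<le> 4" using True that by (intro gap_cutoff'_bounded) auto
      ultimately show ?thesis by linarith
    next
      case False
      then show ?thesis using K0 by (simp add: gap_plus'_def deriv_approx cutoff_eq_0)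
    qed
    show "(\<lambda>m. deriv (approx m) t) \<longlonglongrightarrow> gap_plus' t" if "t \<in> I" for t
    proof (cases "t > 0")
      case True
      have "(\<lambda>m. deriv gap t * cutoff (real (m + 2)) t + gap t * cutoff' (real (m + 2)) t) \<longlonglongrightarrow> deriv gap t * 1 + 0"
        using True that LIMSEQ_ignore_initial_segment[OF cutoff_tendsto_1, of t 2]
          LIMSEQ_ignore_initial_segment[OF gap_cutoff'_tendsto_0, of t 2]
        by (intro tendsto_intros) auto
      then show ?thesis using True by (simp add: gap_plus'_def deriv_approx)
    next
      case False
      then show ?thesis by (simp add: gap_plus'_def deriv_approx cutoff_eq_0)
    qed
  qed
qed

text \<open>
  The functions \<open>approx m\<close> approximate the difference to the datum in the norm of \<open>H\<^sup>1\<close>, by dominated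
  convergence for the functions and for their derivatives.
\<close>

lemma competitor_in_navier: "(\<lambda>x. competitor (x 0)) \<in> navier 1 B (\<lambda>x. datum (x 0))"
proof -
  let ?u = "\<lambda>x::point. competitor (x 0) - datum (x 0)"
  have u: "?u = (\<lambda>x. gap_plus (x 0))" by (simp add: gap_plus_eq)
  have L2: "gap_plus \<in> L2I" by (intro L2I_continuous gap_plus_continuous)
  have H1: "?u \<in> H 1 1 B"
    unfolding H_iff u lift_pt
  proof (intro conjI allI impI L2)
    fix j :: nat assume "j \<le> 1"
    then consider "j = 0" | "j = 1" by linarith
    then show "\<exists>v\<in>L2I. weak_I j gap_plus v"
      by cases (use weak_I_0 L2 weak_I_gap_plus gap_plus'_L2I in blast)+
  qed
  have norm: "H1_norm 1 B (\<lambda>x. ?u x - approx m (x 0)) =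
      sqrt ((\<integral>t. (gap_plus t - approx m t)\<^sup>2 \<partial>lebI) + (\<integral>t. (gap_plus' t - deriv (approx m) t)\<^sup>2 \<partial>lebI))" for m
  proof -
    note t = approx_test[of m] test_I_deriv[OF approx_test[of m]]
    have "(\<lambda>t. gap_plus' t - deriv (approx m) t) \<in> L2I"
      by (intro L2I_diff gap_plus'_L2I test_I_L2I t)
    moreover have "weak_I 1 (\<lambda>t. gap_plus t - approx m t) (\<lambda>t. gap_plus' t - deriv (approx m) t)"
      by (intro weak_I_diff weak_I_gap_plus weak_I_test t locally_integrable_L2I L2 gap_plus'_L2I test_I_L2I)
    ultimately show ?thesis
      using H1_norm_eq[of "\<lambda>t. gap_plus' t - deriv (approx m) t" "\<lambda>x. ?u x - approx m (x 0)"]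
      by (simp add: o_def gap_plus_eq)
  qed
  have "(\<lambda>m. H1_norm 1 B (\<lambda>x. ?u x - approx m (x 0))) \<longlonglongrightarrow> sqrt (0 + 0)"
    unfolding norm by (intro tendsto_intros approx_L2_limit approx'_L2_limit)
  moreover have "test_function 1 B (\<lambda>x. approx m (x 0))" for m
    by (simp only: test_function_iff lift_pt approx_test)
  ultimately have "?u \<in> H1_0 1 B"
    unfolding H1_0_def using H1 by (auto intro!: exI[of _ "\<lambda>m x. approx m (x 0)"])
  then show ?thesis using competitor_in_H2 by (simp add: navier_def)
qed

section \<open>The energy of twice continuously differentiable functions\<close>

lemma derivative_zero_at_limpt_of_zeros:
  fixes g :: "real \<Rightarrow> real"
  assumes "(g has_real_derivative D) (at p)" "p islimpt {t. g t = 0}"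
  shows "g p = 0" "D = 0"
proof -
  obtain x where x: "\<And>n. x n \<in> {t. g t = 0} - {p}" "x \<longlonglongrightarrow> p"
    using assms(2) unfolding islimpt_sequential by auto
  have "isCont g p" using assms(1) by (rule DERIV_isCont)
  then have "(\<lambda>n. g (x n)) \<longlonglongrightarrow> g p" using x(2) by (rule isCont_tendsto_compose)
  moreover have "(\<lambda>n. g (x n)) = (\<lambda>n. 0)" using x(1) by auto
  ultimately show 0: "g p = 0" by (simp add: LIMSEQ_const_iff)
  have "filterlim x (at p) sequentially"
    using x by (auto simp: filterlim_at)
  from filterlim_compose[OF assms(1)[unfolded has_field_derivative_iff] this]
  have "(\<lambda>n. (g (x n) - g p) / (x n - p)) \<longlonglongrightarrow> D" .
  moreover have "(\<lambda>n. (g (x n) - g p) / (x n - p)) = (\<lambda>n. 0)" using x(1) 0 by auto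
  ultimately show "D = 0" by (simp add: LIMSEQ_const_iff)
qed

text \<open>
  By Rolle's theorem there is a zero of the derivative between \<open>p\<close> and each nearby zero of \<open>f\<close>.
\<close>

lemma limpt_of_derivative_zeros:
  fixes f :: "real \<Rightarrow> real"
  assumes f: "\<And>t. t \<in> I \<Longrightarrow> (f has_real_derivative f' t) (at t)" and p: "p \<in> I"
    and limpt: "p islimpt {t \<in> I. f t = 0}"
  shows "p islimpt {t. f' t = 0}"
  unfolding islimpt_approachable
proof (intro allI impI)
  fix e :: real assume "e > 0"
  have fp: "f p = 0"
    by (rule derivative_zero_at_limpt_of_zeros(1)[OF f[OF p] islimpt_subset[OF limpt]]) auto
  obtain x where x: "x \<in> I" "f x = 0" "x \<noteq> p" "dist x p < e"
    using limpt \<open>e > 0\<close> unfolding islimpt_approachable by blast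
  define a b where "a = min x p" and "b = max x p"
  have ab: "a < b" "f a = f b" "{a..b} \<subseteq> I"
    using x p fp by (auto simp: a_def b_def min_def max_def)
  have "continuous_on {a..b} f"
    using ab(3) f by (meson DERIV_isCont continuous_at_imp_continuous_on subsetD)
  moreover have "\<And>t. a < t \<Longrightarrow> t < b \<Longrightarrow> (f has_derivative (*) (f' t)) (at t)"
    using ab(3) f unfolding has_field_derivative_def by (meson atLeastAtMost_iff less_imp_le subsetD)
  ultimately obtain z where z: "a < z" "z < b" "(*) (f' z) = (\<lambda>v. 0)"
    using Rolle_deriv[OF ab(1,2), of "\<lambda>t. (*) (f' t)"] by blast
  then have "f' z = 0" by (metis mult.right_neutral)
  moreover have "z \<noteq> p" "dist z p < e"
    using z(1,2) x(4) by (auto simp: a_def b_def dist_real_def)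
  ultimately show "\<exists>t\<in>{t. f' t = 0}. t \<noteq> p \<and> dist t p < e" by auto
qed

lemma AE_lborel_countable: "countable (Z :: real set) \<Longrightarrow> AE t in lborel. t \<notin> Z"
  by (intro AE_not_in countable_imp_null_set_lborel)

text \<open>
  After multiplication by \<open>3L^3\<close>, the difference of the two sides is
  \<open>(L - 1)\<^sup>2 (3L\<^sup>2 + 2L + 1)\<close>.
\<close>

lemma cantilever_bound: "0 < L \<Longrightarrow> 4 / 3 \<le> L + 1 / (3 * L ^ 3)" for L :: real
proof -
  assume L: "0 < L"
  have "0 \<le> (L - 1)\<^sup>2 * (3 * L\<^sup>2 + 2 * L + 1)" using L by (intro mult_nonneg_nonneg) auto
  also have "\<dots> = 3 * L ^ 4 - 4 * L ^ 3 + 1"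
    by (simp add: power2_eq_square power3_eq_cube power4_eq_xxxx algebra_simps)
  finally show ?thesis using L by (simp add: field_simps power3_eq_cube power4_eq_xxxx)
qed

text \<open>
  Since \<open>f\<close> and \<open>f'\<close> vanish at \<open>p\<close>, the integral of \<open>(r - t) f''(t)\<close> over \<open>[p, r]\<close> is \<open>f r\<close>.
  Expanding the square of \<open>f'' - a (r - t)\<close> therefore bounds the bending energy from below for any
  \<open>a\<close>. The term \<open>d * k\<^sup>2\<close> keeps what a deviation of \<open>f''\<close> from the optimal profile near \<open>p\<close> costs;
  it is the source of the strict inequality.
\<close>

lemma bending_integral_bound:
  fixes f f' f'' :: "real \<Rightarrow> real"
  assumes f: "\<And>t. t \<in> I \<Longrightarrow> (f has_real_derivative f' t) (at t)"
    and f': "\<And>t. t \<in> I \<Longrightarrow> (f' has_real_derivative f'' t) (at t)"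
    and cont: "continuous_on I f''"
    and p: "-1 < p" "p < r" "r < 1" and zero: "f p = 0" "f' p = 0"
    and d: "0 \<le> d" "p + d \<le> r" and k: "0 \<le> k"
    and dev: "\<And>t. t \<in> {p..p + d} \<Longrightarrow> k \<le> \<bar>f'' t - a * (r - t)\<bar>"
  shows "d * k\<^sup>2 + 2 * a * f r - a\<^sup>2 * (r - p) ^ 3 / 3 \<le> integral {p..r} (\<lambda>t. (f'' t)\<^sup>2)"
proof -
  have sub: "{p..r} \<subseteq> I" using p by auto
  have c: "continuous_on {p..r} f''" by (rule continuous_on_subset[OF cont sub])
  let ?X = "integral {p..r} (\<lambda>t. (f'' t)\<^sup>2)" and ?h = "\<lambda>t. (f'' t - a * (r - t))\<^sup>2"
  have h0: "((\<lambda>t. (f'' t)\<^sup>2) has_integral ?X) {p..r}"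
    by (intro integrable_integral integrable_continuous_real continuous_intros c)
  have h1: "((\<lambda>t. (r - t) * f'' t) has_integral ((r - r) * f' r + f r) - ((r - p) * f' p + f p)) {p..r}"
  proof (rule fundamental_theorem_of_calculus)
    fix t assume "t \<in> {p..r}"
    then have "t \<in> I" using sub by auto
    then have "((\<lambda>t. (r - t) * f' t + f t) has_real_derivative (r - t) * f'' t) (at t within {p..r})"
      by (auto intro!: derivative_eq_intros DERIV_subset[OF f] DERIV_subset[OF f'])
    then show "((\<lambda>t. (r - t) * f' t + f t) has_vector_derivative (r - t) * f'' t) (at t within {p..r})"
      by (simp add: has_real_derivative_iff_has_vector_derivative)
  qed (use p in auto)
  have h2: "((\<lambda>t. (r - t)\<^sup>2) has_integral (- ((r - r) ^ 3 / 3)) - (- ((r - p) ^ 3 / 3))) {p..r}"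
  proof (rule fundamental_theorem_of_calculus)
    fix t assume "t \<in> {p..r}"
    have "((\<lambda>t. - ((r - t) ^ 3 / 3)) has_real_derivative (r - t)\<^sup>2) (at t within {p..r})"
      by (auto intro!: derivative_eq_intros)
    then show "((\<lambda>t. - ((r - t) ^ 3 / 3)) has_vector_derivative (r - t)\<^sup>2) (at t within {p..r})"
      by (simp add: has_real_derivative_iff_has_vector_derivative)
  qed (use p in auto)
  have "((\<lambda>t. (f'' t)\<^sup>2 - 2 * a * ((r - t) * f'' t) + a\<^sup>2 * (r - t)\<^sup>2) has_integral
      ?X - 2 * a * f r + a\<^sup>2 * ((r - p) ^ 3 / 3)) {p..r}"
    using h0 h1 h2 zero
    by (intro has_integral_add has_integral_diff has_integral_mult_right) simp_all
  moreover have "(f'' t)\<^sup>2 - 2 * a * ((r - t) * f'' t) + a\<^sup>2 * (r - t)\<^sup>2 = ?h t" for t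
    by (simp add: power2_eq_square algebra_simps)
  ultimately have h: "integral {p..r} ?h = ?X - 2 * a * f r + a\<^sup>2 * ((r - p) ^ 3 / 3)"
    by (simp add: integral_unique)
  have ci: "?h integrable_on {p..s}" if "s \<le> r" for s
    using that by (intro integrable_continuous_real continuous_intros continuous_on_subset[OF c]) auto
  have "d * k\<^sup>2 = integral {p..p + d} (\<lambda>t. k\<^sup>2)" using d by simp
  also have "\<dots> \<le> integral {p..p + d} ?h"
  proof (rule integral_le)
    show "k\<^sup>2 \<le> ?h t" if "t \<in> {p..p + d}" for t
      using dev[OF that] k by (simp add: abs_le_square_iff[symmetric])
  qed (use ci[OF d(2)] in auto)
  also have "\<dots> \<le> integral {p..r} ?h"
    by (rule integral_subset_le) (use d ci in auto)
  finally show ?thesis using h by simp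
qed

text \<open>
  The bound \<open>bending_integral_bound\<close> is used for \<open>r < 1\<close>, where everything is classical, with
  \<open>a = 1/L^3\<close> and with \<open>d\<close> and \<open>k\<close> independent of \<open>r\<close>. In the limit \<open>r \<rightarrow> 1\<close> it stays strict.
\<close>

lemma C2_energy_gt:
  fixes f f' f'' :: "real \<Rightarrow> real"
  assumes f: "\<And>t. t \<in> I \<Longrightarrow> (f has_real_derivative f' t) (at t)"
    and f': "\<And>t. t \<in> I \<Longrightarrow> (f' has_real_derivative f'' t) (at t)"
    and cont: "continuous_on I f''" and L2: "f'' \<in> L2I"
    and bdry: "(f \<longlongrightarrow> 1 / 3) (at_left 1)"
  shows "4 / 3 < (\<integral>t. energy f f'' t \<partial>lebI)"
proof -
  define Z where "Z = {t \<in> I. f t = 0}"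
  have fcont: "continuous_on I f"
    by (meson f DERIV_isCont continuous_at_imp_continuous_on)
  have int: "integrable lebI (energy f f'')"
    by (intro energy_integrable continuous_on_I_measurable fcont L2)
  have null: "AE t in lborel. t \<in> J \<longrightarrow> f t \<noteq> 0"
    if "open J" "J \<subseteq> I" "\<And>t. t \<in> J \<Longrightarrow> \<not> t islimpt Z" for J
  proof -
    have "countable (J \<inter> Z)"
      using that by (intro sparse_imp_countable) (auto simp: sparse_in_open)
    from AE_lborel_countable[OF this] show ?thesis
      by eventually_elim (use that(2) in \<open>auto simp: Z_def\<close>)
  qed
  show ?thesis
  proof (cases "\<exists>t\<in>I. t islimpt Z")
    case False
    have "2 = (\<integral>t. (1::real) \<partial>lebI)" using measure_lebI_space by simp
    also have "\<dots> \<le> (\<integral>t. energy f f'' t \<partial>lebI)"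
    proof (rule integral_mono_AE)
      show "integrable lebI (\<lambda>t. 1 :: real)"
        by (rule finite_measure.integrable_const[OF finite_measure_lebI])
      have "AE t in lborel. t \<in> I \<longrightarrow> f t \<noteq> 0" using False by (intro null) auto
      then show "AE t in lebI. 1 \<le> energy f f'' t"
        unfolding AE_lebI_iff by eventually_elim (auto simp: energy_def)
    qed (rule int)
    finally show ?thesis by simp
  next
    case True
    then obtain a0 where a0: "a0 \<in> I" "a0 islimpt Z" by blast
    have "eventually (\<lambda>t. 0 < f t) (at_left 1)"
      using order_tendstoD(1)[OF bdry, of 0] by simp
    then obtain b0 where b0: "b0 < 1" "\<And>t. b0 < t \<Longrightarrow> t < 1 \<Longrightarrow> 0 < f t"
      unfolding eventually_at_left_field by blast
    define b where "b = max a0 b0"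
    have b: "b < 1" "a0 \<le> b" "\<And>t. b < t \<Longrightarrow> t < 1 \<Longrightarrow> 0 < f t"
      using b0 a0(1) by (auto simp: b_def)
    (* Zeros do not accumulate beyond b, hence the largest accumulation point exists. *)
    have "compact ({a0..b} \<inter> {t. t islimpt Z})"
      by (intro compact_Int_closed closed_limpts) auto
    moreover have "{a0..b} \<inter> {t. t islimpt Z} \<noteq> {}" using a0 b(2) by auto
    ultimately obtain p where p: "p \<in> {a0..b}" "p islimpt Z"
      and pmax: "\<And>t. t \<in> {a0..b} \<Longrightarrow> t islimpt Z \<Longrightarrow> t \<le> p"
      using compact_attains_sup[of "{a0..b} \<inter> {t. t islimpt Z}"] by blast
    have pI: "p \<in> I" using p(1) a0(1) b(1) by auto
    have nolimpt: "\<not> t islimpt Z" if t: "t \<in> {p<..<1}" for t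
    proof
      assume lim: "t islimpt Z"
      show False
      proof (cases "t \<le> b")
        case True
        then show False using pmax[OF _ lim] t p(1) by auto
      next
        case False
        then obtain y where "y \<in> Z" "y \<in> {b<..<1}"
          using islimptE[OF lim, of "{b<..<1}"] t by auto
        then show False using b(3)[of y] by (auto simp: Z_def)
      qed
    qed
    have Zsub: "p islimpt {t. f t = 0}" by (rule islimpt_subset[OF p(2)]) (auto simp: Z_def)
    have f0: "f p = 0" "f' p = 0"
      using derivative_zero_at_limpt_of_zeros[OF f[OF pI] Zsub] by simp_all
    have f2: "f'' p = 0"
      using derivative_zero_at_limpt_of_zeros(2)[OF f'[OF pI]
          limpt_of_derivative_zeros[OF f pI p(2)[unfolded Z_def]]] by simp
    define L where "L = 1 - p"
    have L: "0 < L" using pI by (auto simp: L_def)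
    define a where "a = 1 / L ^ 3"
    have "a * L ^ 3 = 1" using L by (simp add: a_def)
    then have a: "0 < a" "a\<^sup>2 * L ^ 3 = a"
      using L by (simp add: a_def, simp only: power2_eq_square mult.assoc mult_1_right)
    (* Near p the optimal profile a (r - t) is at least 2k while f'' is below k, so they differ
       by k. *)
    define k where "k = a * L / 4"
    have k: "0 < k" using a L by (simp add: k_def)
    obtain e where e: "e > 0" "\<And>t. t \<in> I \<Longrightarrow> \<bar>t - p\<bar> < e \<Longrightarrow> \<bar>f'' t\<bar> < k"
      using cont[unfolded continuous_on_iff, rule_format, OF pI k] f2 by (auto simp: dist_real_def)
    define d where "d = min (e / 2) (L / 4)"
    have d: "0 < d" "d < e" "d \<le> L / 4" using e(1) L by (auto simp: d_def)
    have bound: "L + d * k\<^sup>2 + 2 * a * f r - a / 3 \<le> (\<integral>t. energy f f'' t \<partial>lebI)"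
      if r: "p + 3 * L / 4 \<le> r" "r < 1" for r
    proof -
      have pr: "p < r" using r L by linarith
      have "d * k\<^sup>2 + 2 * a * f r - a\<^sup>2 * (r - p) ^ 3 / 3 \<le> integral {p..r} (\<lambda>t. (f'' t)\<^sup>2)"
      proof (rule bending_integral_bound[OF f f' cont])
        fix t assume t: "t \<in> {p..p + d}"
        then have "t \<in> I" "\<bar>t - p\<bar> < e" using pI d L r by (auto simp: L_def)
        then have "\<bar>f'' t\<bar> < k" by (rule e(2))
        moreover have "a * (L / 2) \<le> a * (r - t)"
          using t r d a(1) by (intro mult_left_mono) auto
        ultimately show "k \<le> \<bar>f'' t - a * (r - t)\<bar>" unfolding k_def by linarith
      qed (use pI pr r d k f0 in auto)
      moreover have "a\<^sup>2 * (r - p) ^ 3 \<le> a\<^sup>2 * L ^ 3"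
        using pr r by (intro mult_left_mono power_mono) (auto simp: L_def)
      ultimately have X: "d * k\<^sup>2 + 2 * a * f r - a / 3 \<le> integral {p..r} (\<lambda>t. (f'' t)\<^sup>2)"
        using a(2) by linarith
      have si: "set_integrable lborel {p..r} (\<lambda>t. (f'' t)\<^sup>2)"
        using pI r by (intro borel_integrable_atLeastAtMost' continuous_intros continuous_on_subset[OF cont]) auto
      have sL: "integrable lborel (indicator {p<..<1} :: real \<Rightarrow> real)"
        using pI by (intro integrable_real_indicator) auto
      have "integral {p..r} (\<lambda>t. (f'' t)\<^sup>2) + L =
          (\<integral>t. indicator {p..r} t *\<^sub>R (f'' t)\<^sup>2 + indicator {p<..<1} t \<partial>lborel)"
        using set_borel_integral_eq_integral(2)[OF si] si sL pI
        by (subst Bochner_Integration.integral_add)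
           (auto simp: set_integrable_def set_lebesgue_integral_def L_def)
      also have "\<dots> \<le> (\<integral>t. indicator I t *\<^sub>R energy f f'' t \<partial>lborel)"
      proof (rule integral_mono_AE)
        show "integrable lborel (\<lambda>t. indicator {p..r} t *\<^sub>R (f'' t)\<^sup>2 + indicator {p<..<1} t)"
          using si sL by (auto simp: set_integrable_def)
        show "integrable lborel (\<lambda>t. indicator I t *\<^sub>R energy f f'' t)"
          using int by (simp add: integrable_lebI_iff set_integrable_def)
        have "AE t in lborel. t \<in> {p<..<1} \<longrightarrow> f t \<noteq> 0"
          using nolimpt pI by (intro null) auto
        then show "AE t in lborel. indicator {p..r} t *\<^sub>R (f'' t)\<^sup>2 + indicator {p<..<1} t
            \<le> indicator I t *\<^sub>R energy f f'' t"
          by eventually_elim (use pI r in \<open>auto simp: indicator_def energy_def\<close>)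
      qed
      also have "\<dots> = (\<integral>t. energy f f'' t \<partial>lebI)"
        by (simp add: integral_lebI_eq set_lebesgue_integral_def)
      finally show ?thesis using X by linarith
    qed
    have "L + d * k\<^sup>2 + 2 * a * (1 / 3) - a / 3 \<le> (\<integral>t. energy f f'' t \<partial>lebI)"
    proof (rule tendsto_upperbound)
      show "((\<lambda>r. L + d * k\<^sup>2 + 2 * a * f r - a / 3) \<longlongrightarrow> L + d * k\<^sup>2 + 2 * a * (1 / 3) - a / 3) (at_left 1)"
        by (intro tendsto_intros bdry)
      have "p + L = 1" by (simp add: L_def)
      then have "p + 3 * L / 4 < 1" using L by linarith
      then show "\<forall>\<^sub>F r in at_left 1. L + d * k\<^sup>2 + 2 * a * f r - a / 3 \<le> (\<integral>t. energy f f'' t \<partial>lebI)"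
        unfolding eventually_at_left_field using bound by (intro exI[of _ "p + 3 * L / 4"]) auto
    qed simp
    moreover have "0 < d * k\<^sup>2" using d k by simp
    moreover have "4 / 3 \<le> L + a / 3" using cantilever_bound[OF L] by (simp add: a_def)
    ultimately show ?thesis by linarith
  qed
qed

section \<open>Boundary values and conclusion\<close>

text \<open>
  As \<open>(z\<^sup>2)' = 2 z z' \<le> z\<^sup>2 + z'\<^sup>2\<close>, the oscillation of \<open>z\<^sup>2\<close> is at most the squared norm \<open>E\<close> in
  \<open>H\<^sup>1\<close>. Averaging \<open>z(x)\<^sup>2 \<le> z(y)\<^sup>2 + E\<close> over all \<open>y\<close> gives the constant \<open>3/2\<close>.
\<close>

lemma sup_bound_H1:
  fixes z z' :: "real \<Rightarrow> real"
  assumes z: "\<And>t. t \<in> I \<Longrightarrow> (z has_real_derivative z' t) (at t)"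
    and cont: "continuous_on I z'" and L2: "z \<in> L2I" "z' \<in> L2I" and x: "x \<in> I"
  shows "(z x)\<^sup>2 \<le> 3 / 2 * ((\<integral>t. (z t)\<^sup>2 \<partial>lebI) + (\<integral>t. (z' t)\<^sup>2 \<partial>lebI))"
proof -
  let ?h = "\<lambda>t. (z t)\<^sup>2 + (z' t)\<^sup>2"
  define E where "E = (\<integral>t. (z t)\<^sup>2 \<partial>lebI) + (\<integral>t. (z' t)\<^sup>2 \<partial>lebI)"
  have i1: "integrable lebI (\<lambda>t. (z t)\<^sup>2)" and i2: "integrable lebI (\<lambda>t. (z' t)\<^sup>2)"
    using L2 by (auto simp: L2I_def)
  have inth: "set_integrable lborel I ?h"
    using Bochner_Integration.integrable_add[OF i1 i2] by (simp add: integrable_lebI_iff)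
  have E_eq: "E = (LINT t:I|lborel. ?h t)"
    using i1 i2 by (simp add: E_def flip: integral_lebI_eq)
  have zcont: "continuous_on I z" by (meson z DERIV_isCont continuous_at_imp_continuous_on)
  have osc: "\<bar>(z b)\<^sup>2 - (z a)\<^sup>2\<bar> \<le> E" if ab: "a \<le> b" "a \<in> I" "b \<in> I" for a b
  proof -
    have sub: "{a..b} \<subseteq> I" using ab by auto
    have "((\<lambda>t. 2 * z t * z' t) has_integral (z b)\<^sup>2 - (z a)\<^sup>2) {a..b}"
    proof (rule fundamental_theorem_of_calculus)
      fix t assume "t \<in> {a..b}"
      then have "((\<lambda>t. (z t)\<^sup>2) has_real_derivative 2 * z t * z' t) (at t within {a..b})"
        using sub by (auto intro!: derivative_eq_intros DERIV_subset[OF z])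
      then show "((\<lambda>t. (z t)\<^sup>2) has_vector_derivative 2 * z t * z' t) (at t within {a..b})"
        by (simp add: has_real_derivative_iff_has_vector_derivative)
    qed (rule ab)
    moreover have "norm (integral {a..b} (\<lambda>t. 2 * z t * z' t)) \<le> integral {a..b} ?h"
    proof (rule integral_norm_bound_integral)
      show "(\<lambda>t. 2 * z t * z' t) integrable_on {a..b}" "?h integrable_on {a..b}"
        by (intro integrable_continuous_real continuous_intros continuous_on_subset[OF cont sub]
            continuous_on_subset[OF zcont sub])+
      show "norm (2 * z t * z' t) \<le> ?h t" for t
        using sum_squares_bound[of "\<bar>z t\<bar>" "\<bar>z' t\<bar>"] by (simp add: abs_mult)
    qed
    moreover have "integral {a..b} ?h \<le> E"
    proof -
      have s: "set_integrable lborel {a..b} ?h"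
        by (rule set_integrable_subset[OF inth]) (use sub in auto)
      have "integral {a..b} ?h = (LINT t:{a..b}|lborel. ?h t)"
        by (rule set_borel_integral_eq_integral(2)[OF s, symmetric])
      also have "\<dots> \<le> E"
        unfolding E_eq set_lebesgue_integral_def
        using s inth sub by (intro integral_mono) (auto simp: set_integrable_def indicator_def)
      finally show ?thesis .
    qed
    ultimately show ?thesis by (simp add: integral_unique)
  qed
  have "2 * ((z x)\<^sup>2 - E) = (\<integral>y. (z x)\<^sup>2 - E \<partial>lebI)"
    using measure_lebI_space by simp
  also have "\<dots> \<le> (\<integral>y. (z y)\<^sup>2 \<partial>lebI)"
  proof (rule integral_mono[OF finite_measure.integrable_const[OF finite_measure_lebI] i1])
    fix y assume "y \<in> space lebI"
    then have y: "y \<in> I" by simp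
    show "(z x)\<^sup>2 - E \<le> (z y)\<^sup>2"
      using osc[OF _ x y] osc[OF _ y x] by (cases "x \<le> y") auto
  qed
  also have "\<dots> \<le> E" by (simp add: E_def)
  finally show ?thesis unfolding E_def[symmetric] by simp
qed

lemma L2I_cong_AE:
  assumes "v \<in> L2I" "AE t in lebI. v t = f t" "f \<in> borel_measurable lebI"
  shows "f \<in> L2I"
proof -
  have "integrable lebI (\<lambda>t. (f t)\<^sup>2)"
  proof (rule integrable_cong_AE_imp)
    show "integrable lebI (\<lambda>t. (v t)\<^sup>2)" using assms(1) by (simp add: L2I_def)
    show "AE t in lebI. (v t)\<^sup>2 = (f t)\<^sup>2" using assms(2) by eventually_elim simp
    show "(\<lambda>t. (f t)\<^sup>2) \<in> borel_measurable lebI" using assms(3) by simp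
  qed
  with assms(3) show ?thesis by (simp add: L2I_def)
qed

text \<open>
  Near the endpoint \<open>1\<close> a test function vanishes, so there \<open>f\<close> coincides with its distance to the test
  function, which is uniformly small by the sup-norm bound.
\<close>

lemma H1_0_boundary_limit:
  assumes w: "(\<lambda>x. w x) \<in> H1_0 1 B" and f: "AE t in lebI. w (pt t) = f t"
    and wL2: "w \<circ> pt \<in> L2I"
    and df: "\<And>t. t \<in> I \<Longrightarrow> (f has_real_derivative f' t) (at t)"
    and cont: "continuous_on I f'" and L2: "f \<in> L2I" "f' \<in> L2I"
  shows "(f \<longlongrightarrow> 0) (at_left 1)"
proof -
  obtain \<eta> where \<eta>: "\<And>m. test_function 1 B (\<eta> m)"
    and lim: "(\<lambda>m. H1_norm 1 B (\<lambda>x. w x - \<eta> m x)) \<longlonglongrightarrow> 0"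
    using w unfolding H1_0_def by auto
  define g where "g m = \<eta> m \<circ> pt" for m
  have g: "test_I (g m)" for m using \<eta>[of m] by (simp add: test_function_iff g_def)
  have fcont: "continuous_on I f" by (meson df DERIV_isCont continuous_at_imp_continuous_on)
  define E where "E m = (\<integral>t. (f t - g m t)\<^sup>2 \<partial>lebI) + (\<integral>t. (f' t - deriv (g m) t)\<^sup>2 \<partial>lebI)" for m
  have E: "E m = (H1_norm 1 B (\<lambda>x. w x - \<eta> m x))\<^sup>2" for m
  proof -
    have gL2: "g m \<in> L2I" "deriv (g m) \<in> L2I" by (intro test_I_L2I test_I_deriv g)+
    have comp: "(\<lambda>x. w x - \<eta> m x) \<circ> pt = (\<lambda>t. (w \<circ> pt) t - g m t)" by (simp add: g_def o_def)
    have meas: "f \<in> borel_measurable lebI" "w \<circ> pt \<in> borel_measurable lebI" "g m \<in> borel_measurable lebI"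
      using L2 wL2 gL2 by (auto simp: L2I_def)
    have "weak_I 1 f f'"
      by (rule weak_I_classical[of _ "{}"]) (auto intro: fcont df locally_integrable_L2I L2)
    moreover have "AE t in lebI. f t = (w \<circ> pt) t" using f by eventually_elim simp
    ultimately have "weak_I 1 (w \<circ> pt) f'" using meas(1,2) by (rule weak_I_cong_AE)
    then have weak_I: "weak_I 1 ((\<lambda>x. w x - \<eta> m x) \<circ> pt) (\<lambda>t. f' t - deriv (g m) t)"
      unfolding comp by (intro weak_I_diff weak_I_test g locally_integrable_L2I wL2 L2 gL2)
    have "H1_norm 1 B (\<lambda>x. w x - \<eta> m x) =
        sqrt ((\<integral>t. (w (pt t) - \<eta> m (pt t))\<^sup>2 \<partial>lebI) + (\<integral>t. (f' t - deriv (g m) t)\<^sup>2 \<partial>lebI))"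
      by (rule H1_norm_eq[OF L2I_diff[OF L2(2) gL2(2)] weak_I])
    also have "(\<integral>t. (w (pt t) - \<eta> m (pt t))\<^sup>2 \<partial>lebI) = (\<integral>t. (f t - g m t)\<^sup>2 \<partial>lebI)"
    proof (rule integral_cong_AE)
      show "AE t in lebI. (w (pt t) - \<eta> m (pt t))\<^sup>2 = (f t - g m t)\<^sup>2"
        using f by eventually_elim (simp add: g_def)
    qed (use meas in \<open>auto simp: g_def o_def intro!: borel_measurable_power borel_measurable_diff\<close>)
    finally show ?thesis unfolding E_def by simp
  qed
  have "(\<lambda>m. 3 / 2 * E m) \<longlonglongrightarrow> 3 / 2 * 0\<^sup>2" unfolding E by (intro tendsto_intros lim)
  then have E_lim: "(\<lambda>m. 3 / 2 * E m) \<longlonglongrightarrow> 0" by simp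
  show ?thesis
    unfolding tendsto_iff dist_real_def
  proof (intro allI impI)
    fix e :: real assume "e > 0"
    then have "0 < e\<^sup>2" by simp
    from order_tendstoD(2)[OF E_lim this] obtain m where m: "3 / 2 * E m < e\<^sup>2"
      by (auto simp: eventually_sequentially)
    obtain r where r: "0 < r" "r < 1" "\<And>t. t \<in> I \<Longrightarrow> r < \<bar>t\<bar> \<Longrightarrow> g m t = 0"
      using g[of m] by (auto simp: test_I_def)
    have "\<bar>f t - 0\<bar> < e" if t: "r < t" "t < 1" for t
    proof -
      have tI: "t \<in> I" using t r(1) by auto
      have "(f t - g m t)\<^sup>2 \<le> 3 / 2 * E m"
        unfolding E_def
      proof (rule sup_bound_H1[OF _ _ _ _ tI])
        show "((\<lambda>t. f t - g m t) has_real_derivative f' s - deriv (g m) s) (at s)" if "s \<in> I" for s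
          by (intro DERIV_diff df test_I_DERIV g that)
        show "continuous_on I (\<lambda>t. f' t - deriv (g m) t)"
          by (intro continuous_on_diff cont test_I_continuous_on test_I_deriv g)
      qed (intro L2I_diff L2 test_I_L2I test_I_deriv g)+
      with m have "(f t - g m t)\<^sup>2 < e\<^sup>2" by linarith
      moreover have "g m t = 0" using r(3)[OF tI] t r(1) by simp
      ultimately have "\<bar>f t\<bar>\<^sup>2 < e\<^sup>2" by simp
      then have "\<bar>f t\<bar> < e" by (rule power2_less_imp_less) (use \<open>e > 0\<close> in simp)
      then show ?thesis by simp
    qed
    then show "\<forall>\<^sub>F t in at_left 1. \<bar>f t - 0\<bar> < e"
      unfolding eventually_at_left_field using r(2) by blast
  qed
qed

lemma datum_1: "datum 1 = 1 / 3"
  by (simp add: datum_def flat_def cubic_def mult_exp_exp)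

text \<open>
  The classical derivatives of the \<open>C\<^sup>2\<close> representative agree almost everywhere with the weak
  derivatives of \<open>u\<close>. Hence they are square-integrable and may be used to compute \<open>F\<close>, and the
  boundary value \<open>1/3\<close> at \<open>1\<close> is attained as a limit.
\<close>

lemma C2_in_navier_energy_gt:
  assumes u: "u \<in> navier 1 B (\<lambda>x. datum (x 0))" and C2: "lies_in_C_k 1 2 B u"
  shows "4 / 3 < F 1 B u"
proof -
  obtain w where w: "C_k 1 2 B w" "AE x in vol_on 1 B. u x = w x"
    using C2 by (auto simp: lies_in_C_k_def)
  define f where "f = w \<circ> pt"
  have j: "\<forall>j\<le>2. continuous_on I ((deriv ^^ j) f)"
    "\<forall>j<2. \<forall>t\<in>I. (deriv ^^ j) f differentiable (at t)"
    using w(1) unfolding C_k_ball_iff f_def by auto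
  have two: "(deriv ^^ 2) f = deriv (deriv f)" "(deriv ^^ 1) f = deriv f"
    by (simp_all add: numeral_2_eq_2 One_nat_def)
  have f: "(f has_real_derivative deriv f t) (at t)" if "t \<in> I" for t
    using j(2)[rule_format, of 0] that by (simp add: DERIV_deriv_iff_real_differentiable)
  have f': "(deriv f has_real_derivative deriv (deriv f) t) (at t)" if "t \<in> I" for t
    using j(2)[rule_format, of 1] that two by (simp add: DERIV_deriv_iff_real_differentiable)
  have c0: "continuous_on I f" using j(1)[rule_format, of 0] by simp
  have c1: "continuous_on I (deriv f)" using j(1)[rule_format, of 1] two by simp
  have c2: "continuous_on I (deriv (deriv f))" using j(1)[rule_format, of 2] two by simp
  note meas = continuous_on_I_measurable[OF c0] continuous_on_I_measurable[OF c1]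
    continuous_on_I_measurable[OF c2]
  have uf: "AE t in lebI. u (pt t) = f t"
    using AE_ball_D[OF w(2)] by (simp add: f_def)
  then have fu: "AE t in lebI. f t = (u \<circ> pt) t" by eventually_elim simp
  have uH: "u \<in> H 1 2 B" and u0: "(\<lambda>x. u x - datum (x 0)) \<in> H1_0 1 B"
    using u by (auto simp: navier_def)
  have uL2: "u \<circ> pt \<in> L2I" and wdH: "\<And>j. j \<le> 2 \<Longrightarrow> \<exists>v\<in>L2I. weak_I j (u \<circ> pt) v"
    using uH unfolding H_iff by auto
  obtain v1 v2 where v: "v1 \<in> L2I" "weak_I 1 (u \<circ> pt) v1" "v2 \<in> L2I" "weak_I 2 (u \<circ> pt) v2"
    using wdH[of 1] wdH[of 2] by auto
  have umeas: "u \<circ> pt \<in> borel_measurable lebI" using uL2 by (simp add: L2I_def)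
  have fL2: "f \<in> L2I" by (rule L2I_cong_AE[OF uL2 _ meas(1)]) (use uf in simp)
  have wd1: "weak_I 1 f (deriv f)" "weak_I 1 (deriv f) (deriv (deriv f))"
    using weak_I_classical[OF c0 finite.emptyI, of "deriv f"] weak_I_classical[OF c1 finite.emptyI, of "deriv (deriv f)"]
    by (simp_all only: Diff_empty f f' locally_integrable_continuous c1 c2)
  have wdu: "weak_I 1 (u \<circ> pt) (deriv f)" "weak_I 2 (u \<circ> pt) (deriv (deriv f))"
    by (rule weak_I_cong_AE[OF _ fu meas(1) umeas], rule wd1 weak_I_trans_1_1[OF wd1])+
  have f'L2: "deriv f \<in> L2I"
    by (rule L2I_cong_AE[OF v(1) weak_I_unique[OF v(2) wdu(1)] meas(2)])
       (intro locally_integrable_L2I locally_integrable_continuous v c1)+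
  have f''L2: "deriv (deriv f) \<in> L2I"
    by (rule L2I_cong_AE[OF v(3) weak_I_unique[OF v(4) wdu(2)] meas(3)])
       (intro locally_integrable_L2I locally_integrable_continuous v c2)+
  have dL2: "datum \<in> L2I" "deriv datum \<in> L2I"
    by (intro L2I_continuous smooth_alg_continuous_on smooth_alg_deriv datum_smooth)+
  have "((\<lambda>t. f t - datum t) \<longlongrightarrow> 0) (at_left 1)"
  proof (rule H1_0_boundary_limit[OF u0])
    show "AE t in lebI. u (pt t) - datum (pt t 0) = f t - datum t"
      using uf by eventually_elim simp
    show "(\<lambda>x. u x - datum (x 0)) \<circ> pt \<in> L2I"
      using L2I_diff[OF uL2 dL2(1)] by (simp add: o_def)
    show "((\<lambda>t. f t - datum t) has_real_derivative deriv f t - deriv datum t) (at t)" if "t \<in> I" for t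
      using smooth_alg_differentiable[OF datum_smooth, of t] that
      by (intro DERIV_diff f) (auto simp: DERIV_deriv_iff_real_differentiable)
    show "continuous_on I (\<lambda>t. deriv f t - deriv datum t)"
      by (intro continuous_on_diff c1 smooth_alg_continuous_on smooth_alg_deriv datum_smooth)
  qed (intro L2I_diff fL2 f'L2 dL2)+
  moreover have "(datum \<longlongrightarrow> datum 1) (at_left 1)"
  proof (rule tendsto_within_subset[OF isContD])
    show "isCont datum 1"
      by (rule differentiable_imp_continuous_within[OF smooth_alg_differentiable[OF datum_smooth]])
  qed simp
  ultimately have "((\<lambda>t. (f t - datum t) + datum t) \<longlongrightarrow> 0 + datum 1) (at_left 1)"
    by (rule tendsto_add)
  then have "(f \<longlongrightarrow> 1 / 3) (at_left 1)" by (simp add: datum_1)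
  then have "4 / 3 < (\<integral>t. energy f (deriv (deriv f)) t \<partial>lebI)"
    by (intro C2_energy_gt[OF f f' c2 f''L2])
  also have "\<dots> = F 1 B u"
    by (rule F_eq[OF f''L2 wdu(2) uL2 meas(1) uf, symmetric])
  finally show ?thesis .
qed

theorem corollary2:
  "\<exists>n\<ge>1. \<exists>\<phi>. C_infinity_closure n (unit_ball n) \<phi> \<and>
     (\<forall>u. minimiser n (unit_ball n) \<phi> u \<longrightarrow> \<not> lies_in_C_k n 2 (unit_ball n) u)"
proof (intro exI[of _ 1] conjI exI[of _ "\<lambda>x. datum (x 0)"] allI impI notI)
  show "C_infinity_closure 1 B (\<lambda>x. datum (x 0))"
    by (rule lift_smooth_C_infinity_closure[OF datum_smooth])
  fix u assume min: "minimiser 1 B (\<lambda>x. datum (x 0)) u" and C2: "lies_in_C_k 1 2 B u"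
  then have "u \<in> navier 1 B (\<lambda>x. datum (x 0))" "\<not> F 1 B (\<lambda>x. competitor (x 0)) < F 1 B u"
    using competitor_in_navier by (auto simp: minimiser_def is_arg_min_def)
  then show False using C2_in_navier_energy_gt[OF _ C2] F_competitor by linarith
qed simp

end
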